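(* Let $G$ be a virtually polycyclic group and $\mu$ a symmetric probability measure on $G$ whose support generates $G$ as a group, such that the $\mu$-random walk on $G$ is Liouville. Then $(G,\mu)$ is algebraically recurrent.
   Context: A $\mu$-random walk is $X_n=\zeta_1\cdots\zeta_n$ with $\zeta_i$ i.i.d. of law $\mu$; it is Liouville if every bounded $\mu$-harmonic function on $G$ is constant (trivial Poisson boundary). $\mathcal{S}_n$ denotes the semigroup generated by $\{X_n,X_{n+1},\ldots\}$, and $(G,\mu)$ is algebraically recurrent if for every $n$, $\mathcal{S}_n=G$ almost surely. Symmetric means $\mu(g)=\mu(g^{-1})$ for all $g$. *)

theory Defs
  imports "HOL-Probability.Probability" "HOL-Algebra.Algebra"
begin

definition polycyclic :: "('a, 'b) monoid_scheme \<Rightarrow> bool" where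
  "polycyclic G \<longleftrightarrow> group G \<and>
     (\<exists>(Hs :: nat \<Rightarrow> 'a set) (k::nat).
        Hs 0 = carrier G \<and> Hs k = {\<one>\<^bsub>G\<^esub>} \<and>
        (\<forall>i\<le>k. subgroup (Hs i) G) \<and>
        (\<forall>i<k. Hs (Suc i) \<lhd> subgroup_generated G (Hs i) \<and>
               cyclic_group (subgroup_generated G (Hs i) Mod Hs (Suc i))))"

definition virtually_polycyclic :: "('a, 'b) monoid_scheme \<Rightarrow> bool" where
  "virtually_polycyclic G \<longleftrightarrow> group G \<and>
     (\<exists>H. subgroup H G \<and> finite (rcosets\<^bsub>G\<^esub> H) \<and> polycyclic (subgroup_generated G H))"

text \<open>Position of the right random walk X_n = \<zeta>_1 ... \<zeta>_n, where the increments
  are the coordinates \<omega> 0, \<omega> 1, ... of a sample path (X_0 = 1).\<close>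
primrec rw_pos :: "('a, 'b) monoid_scheme \<Rightarrow> (nat \<Rightarrow> 'a) \<Rightarrow> nat \<Rightarrow> 'a" where
  "rw_pos G \<omega> 0 = \<one>\<^bsub>G\<^esub>"
| "rw_pos G \<omega> (Suc n) = rw_pos G \<omega> n \<otimes>\<^bsub>G\<^esub> \<omega> n"

definition path_space :: "'a pmf \<Rightarrow> (nat \<Rightarrow> 'a) measure" where
  "path_space \<mu> = PiM UNIV (\<lambda>_::nat. measure_pmf \<mu>)"

inductive_set sgen :: "('a, 'b) monoid_scheme \<Rightarrow> 'a set \<Rightarrow> 'a set"
  for G and A where
  base: "x \<in> A \<Longrightarrow> x \<in> sgen G A"
| mult: "x \<in> sgen G A \<Longrightarrow> y \<in> sgen G A \<Longrightarrow> x \<otimes>\<^bsub>G\<^esub> y \<in> sgen G A"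

definition symmetric_measure :: "('a, 'b) monoid_scheme \<Rightarrow> 'a pmf \<Rightarrow> bool" where
  "symmetric_measure G \<mu> \<longleftrightarrow> (\<forall>g\<in>carrier G. pmf \<mu> g = pmf \<mu> (inv\<^bsub>G\<^esub> g))"

definition mu_harmonic :: "('a, 'b) monoid_scheme \<Rightarrow> 'a pmf \<Rightarrow> ('a \<Rightarrow> real) \<Rightarrow> bool" where
  "mu_harmonic G \<mu> f \<longleftrightarrow>
     (\<forall>g\<in>carrier G. f g = measure_pmf.expectation \<mu> (\<lambda>h. f (g \<otimes>\<^bsub>G\<^esub> h)))"

definition liouville :: "('a, 'b) monoid_scheme \<Rightarrow> 'a pmf \<Rightarrow> bool" where
  "liouville G \<mu> \<longleftrightarrow>
     (\<forall>f :: 'a \<Rightarrow> real. (\<exists>B. \<forall>g\<in>carrier G. \<bar>f g\<bar> \<le> B) \<and> mu_harmonic G \<mu> f \<longrightarrow>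
        (\<forall>g\<in>carrier G. \<forall>h\<in>carrier G. f g = f h))"

definition algebraically_recurrent :: "('a, 'b) monoid_scheme \<Rightarrow> 'a pmf \<Rightarrow> bool" where
  "algebraically_recurrent G \<mu> \<longleftrightarrow>
     (\<forall>n. AE \<omega> in path_space \<mu>. sgen G {rw_pos G \<omega> m | m. n \<le> m} = carrier G)"

end

theory Submission
  imports Defs "HOL-Complex_Analysis.Great_Picard"
begin

text \<open>By the Liouville property the averaged convolution powers of the step law are asymptotically
  invariant under left translations. Hence positions of the walk at sparse random times can be
  replaced, at small cost in total variation, by independent elements with symmetric,
  asymptotically invariant laws, and it suffices that these almost surely generate the group as a
  semigroup. The laws being symmetric, all these elements may be inverted simultaneously. Descending
  a subnormal series with cyclic quotients, the semigroup of every tail almost surely meets each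
  coset of each member: in a cyclic quotient it contains elements on either side of the identity in
  every residue class, hence everything. At the trivial subgroup, every group element is reached.\<close>

text \<open>Two obstacles shape the argument. Positions of the walk depend on each other: a position
  after \<open>x\<close> is \<open>x y\<close> with \<open>y\<close> fresh. Left almost invariance
  removes \<open>x\<close>, provided the waiting time is chosen after the law of \<open>x\<close> is
  known; the errors can then be made summable. Time averages are needed because single convolution
  powers may retain a parity, as for steps +1 and -1 on the integers, while averages are almost
  harmonic by telescoping. The other obstacle is that a semigroup offers no inverses, so in an
  infinite cyclic quotient nothing obvious forces elements on both sides of the identity. Symmetry
  of one step says nothing about a single realised path, but for independent draws it makes a set
  and its inverse equally likely to be met. With finitely many pieces covering a subgroup, some
  piece has a fair chance, translation or inversion moves that chance to any other piece, and
  independence of disjoint blocks turns a fair chance into certainty.\<close>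

section \<open>Bounded expectations under discrete laws\<close>

lemma integrable_pmf_bounded:
  fixes f :: "'a \<Rightarrow> real"
  assumes "\<And>x. x \<in> set_pmf p \<Longrightarrow> \<bar>f x\<bar> \<le> B"
  shows "integrable (measure_pmf p) f"
  by (rule measure_pmf.integrable_const_bound[where B=B]) (auto simp: AE_measure_pmf_iff assms)

lemma expectation_bind_bounded:
  fixes f :: "'b \<Rightarrow> real"
  assumes "\<And>x. \<bar>f x\<bar> \<le> B"
  shows "measure_pmf.expectation (bind_pmf p q) f =
    measure_pmf.expectation p (\<lambda>x. measure_pmf.expectation (q x) f)"
  unfolding measure_pmf_bind
  by (rule integral_bind[where K = "count_space UNIV" and B' = 1 and B = B])
     (auto simp: assms measure_pmf.emeasure_space_1 intro!: measure_pmf_in_subprob_algebra)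

lemma prob_bind_pmf:
  "measure_pmf.prob (bind_pmf p q) A = measure_pmf.expectation p (\<lambda>x. measure_pmf.prob (q x) A)"
  using expectation_bind_bounded[of "indicator A" 1 p q] by (simp add: indicator_def)

lemma expectation_mono_pmf:
  fixes f g :: "'a \<Rightarrow> real"
  assumes "\<And>x. x \<in> set_pmf p \<Longrightarrow> f x \<le> g x"
    and "\<And>x. x \<in> set_pmf p \<Longrightarrow> \<bar>f x\<bar> \<le> B" "\<And>x. x \<in> set_pmf p \<Longrightarrow> \<bar>g x\<bar> \<le> C"
  shows "measure_pmf.expectation p f \<le> measure_pmf.expectation p g"
  by (rule integral_mono_AE)
     (auto simp: AE_measure_pmf_iff assms intro: integrable_pmf_bounded[OF assms(2)] integrable_pmf_bounded[OF assms(3)])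

lemma expectation_tendsto_pmf:
  fixes f :: "nat \<Rightarrow> 'a \<Rightarrow> real"
  assumes "\<And>x. x \<in> set_pmf p \<Longrightarrow> (\<lambda>n. f n x) \<longlonglongrightarrow> g x"
    and "\<And>n x. x \<in> set_pmf p \<Longrightarrow> \<bar>f n x\<bar> \<le> B"
  shows "(\<lambda>n. measure_pmf.expectation p (f n)) \<longlonglongrightarrow> measure_pmf.expectation p g"
  by (rule integral_dominated_convergence[where w = "\<lambda>_. B"]) (auto simp: AE_measure_pmf_iff assms)

lemma expectation_pmf_bounds:
  fixes f :: "'a \<Rightarrow> real"
  assumes "\<And>x. x \<in> set_pmf p \<Longrightarrow> 0 \<le> f x \<and> f x \<le> 1"
  shows "0 \<le> measure_pmf.expectation p f \<and> measure_pmf.expectation p f \<le> 1"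
  using expectation_mono_pmf[of p "\<lambda>_. 0" f 1 1] expectation_mono_pmf[of p f "\<lambda>_. 1" 1 1] assms
  by (force simp: abs_le_iff)

section \<open>Generated semigroups\<close>

lemma sgen_mono: "A \<subseteq> B \<Longrightarrow> x \<in> sgen G A \<Longrightarrow> x \<in> sgen G B"
  by (rotate_tac, induction rule: sgen.induct) (auto intro: sgen.intros)

lemma sgen_Un1: "x \<in> sgen G A \<Longrightarrow> x \<in> sgen G (A \<union> B)"
  and sgen_Un2: "x \<in> sgen G B \<Longrightarrow> x \<in> sgen G (A \<union> B)"
  by (rule sgen_mono[rotated], assumption, blast)+

lemma sgen_idem: "A \<subseteq> sgen G B \<Longrightarrow> x \<in> sgen G A \<Longrightarrow> x \<in> sgen G B"
  by (rotate_tac, induction rule: sgen.induct) (auto intro: sgen.intros)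

context group
begin

lemma sgen_closed: "A \<subseteq> carrier G \<Longrightarrow> x \<in> sgen G A \<Longrightarrow> x \<in> carrier G"
  by (rotate_tac, induction rule: sgen.induct) auto

text \<open>Inversion reverses a product, but the reversed product still lies in the semigroup of
  the inverted generators.\<close>

lemma inv_in_sgen:
  assumes "A \<subseteq> carrier G" "x \<in> sgen G A"
  shows "inv x \<in> sgen G (m_inv G ` A)"
  using assms(2)
proof (induction rule: sgen.induct)
  case (mult x y)
  then have "x \<in> carrier G" "y \<in> carrier G" using sgen_closed assms(1) by auto
  with mult show ?case by (auto simp: inv_mult_group intro: sgen.mult)
qed (auto intro: sgen.base)

text \<open>The semigroup need not contain the identity; the trailing factor \<open>b\<close> covers
  \<open>t = 0\<close>.\<close>

lemma pow_mult_in_sgen: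
  assumes "a \<in> carrier G" "b \<in> carrier G"
  shows "a [^] (t::nat) \<otimes> b \<in> sgen G {a, b}"
proof (induction t)
  case 0
  then show ?case using assms by (auto intro: sgen.base)
next
  case (Suc t)
  have "a [^] Suc t \<otimes> b = a \<otimes> (a [^] t \<otimes> b)"
    using assms by (simp add: m_assoc nat_pow_Suc2[unfolded nat_pow_Suc, of a t])
  then show ?case using Suc by (auto intro: sgen.intros)
qed

end

text \<open>The total variation distance between \<open>\<nu>\<close> and its left translate by
  \<open>h\<close>, in dual form; test functions rather than events, because conditional hitting
  probabilities are inserted for \<open>f\<close>.\<close>

definition shift_close :: "('a, 'b) monoid_scheme \<Rightarrow> 'a pmf \<Rightarrow> 'a \<Rightarrow> real \<Rightarrow> bool" where
  "shift_close G \<nu> h \<eta> \<longleftrightarrow> (\<forall>f. (\<forall>x. 0 \<le> f x \<and> f x \<le> 1) \<longrightarrow>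
     \<bar>measure_pmf.expectation \<nu> (\<lambda>x. f (h \<otimes>\<^bsub>G\<^esub> x)) - measure_pmf.expectation \<nu> f\<bar> \<le> \<eta>)"

subsection \<open>Semigroups generated by independent symmetric elements\<close>

locale asymptotically_invariant = group G for G (structure) +
  fixes \<nu> :: "nat \<Rightarrow> 'a pmf"
  assumes supp: "set_pmf (\<nu> i) \<subseteq> carrier G"
    and symm: "map_pmf (m_inv G) (\<nu> i) = \<nu> i"
    and asymp_inv: "h \<in> carrier G \<Longrightarrow> 0 < \<eta> \<Longrightarrow> eventually (\<lambda>i. shift_close G (\<nu> i) h \<eta>) sequentially"
begin

text \<open>Laws of finite lists keep the independent sequence within discrete laws, where every
  event is measurable; almost sure statements become limits in the block length.\<close>

primrec block :: "nat \<Rightarrow> nat \<Rightarrow> 'a list pmf" where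
  "block 0 n = return_pmf []"
| "block (Suc l) n = bind_pmf (\<nu> n) (\<lambda>x. map_pmf ((#) x) (block l (Suc n)))"

definition hit :: "nat \<Rightarrow> nat \<Rightarrow> 'a set \<Rightarrow> real" where
  "hit n l A = measure_pmf.prob (block l n) {L. sgen G (set L) \<inter> A \<noteq> {}}"

text \<open>Since \<open>hit n l A\<close> increases in \<open>l\<close>, the limit is the
  probability that the whole tail from \<open>n\<close> generates an element of \<open>A\<close>.
  Every tail is asked for, so that a target chosen after one block can be met by a later independent
  one.\<close>

definition hit_surely :: "'a set \<Rightarrow> bool" where
  "hit_surely A \<longleftrightarrow> (\<forall>n. (\<lambda>l. hit n l A) \<longlonglongrightarrow> 1)"

lemma set_block: "L \<in> set_pmf (block l n) \<Longrightarrow> set L \<subseteq> carrier G"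
  by (induction l arbitrary: n L) (use supp in fastforce)+

lemma block_add:
  "block (k + l) n = bind_pmf (block k n) (\<lambda>L. map_pmf ((@) L) (block l (n + k)))"
proof (induction k arbitrary: n)
  case 0
  have "(@) [] = (\<lambda>L :: 'a list. L)" by auto
  then show ?case by (simp add: bind_return_pmf pmf.map_ident)
next
  case (Suc k)
  have "(@) (x # L) = (\<lambda>L'. x # L @ L')" for x :: 'a and L by auto
  with Suc show ?case
    by (simp add: bind_assoc_pmf map_bind_pmf bind_map_pmf pmf.map_comp o_def)
qed

lemma block_flip: "map_pmf (map (m_inv G)) (block l n) = block l n"
proof (induction l arbitrary: n)
  case (Suc l)
  have "map_pmf (map (m_inv G)) (block (Suc l) n) =
    bind_pmf (\<nu> n) (\<lambda>x. map_pmf ((#) (inv x)) (map_pmf (map (m_inv G)) (block l (Suc n))))"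
    by (simp add: map_bind_pmf pmf.map_comp o_def)
  also have "\<dots> = bind_pmf (map_pmf (m_inv G) (\<nu> n)) (\<lambda>x. map_pmf ((#) x) (block l (Suc n)))"
    by (simp add: Suc bind_map_pmf)
  finally show ?case by (simp add: symm)
qed simp

lemma hit_bounds: "0 \<le> hit n l A" "hit n l A \<le> 1" "\<bar>hit n l A\<bar> \<le> 1"
  by (simp_all add: hit_def)

lemma hit_add:
  "hit n (k + l) A = measure_pmf.expectation (block k n)
     (\<lambda>L. measure_pmf.prob (block l (n + k)) {L'. sgen G (set L \<union> set L') \<inter> A \<noteq> {}})"
  unfolding hit_def block_add prob_bind_pmf by (simp add: vimage_def)

text \<open>Independent symmetric draws keep their joint law when all are inverted
  (\<open>block_flip\<close>), and this replaces the generated semigroup by the set of its inverses.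
  The comparison is between probabilities only; a realised semigroup need not be closed under
  inverses.\<close>

lemma hit_inv:
  assumes "\<And>a. a \<in> A \<Longrightarrow> inv a \<in> B"
  shows "hit n l A \<le> hit n l B"
proof -
  have "hit n l A = measure_pmf.prob (map_pmf (map (m_inv G)) (block l n)) {L. sgen G (set L) \<inter> A \<noteq> {}}"
    by (simp add: hit_def block_flip)
  also have "\<dots> = measure_pmf.prob (block l n) {L. sgen G (m_inv G ` set L) \<inter> A \<noteq> {}}"
    by (simp add: vimage_def)
  also have "\<dots> \<le> hit n l B"
    unfolding hit_def
  proof (rule measure_pmf.finite_measure_mono_AE)
    show "AE L in measure_pmf (block l n). L \<in> {L. sgen G (m_inv G ` set L) \<inter> A \<noteq> {}} \<longrightarrow> L \<in> {L. sgen G (set L) \<inter> B \<noteq> {}}"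
    proof (unfold AE_measure_pmf_iff, intro ballI impI CollectI notI)
      fix L assume L: "L \<in> set_pmf (block l n)"
        and "L \<in> {L. sgen G (m_inv G ` set L) \<inter> A \<noteq> {}}" and E: "sgen G (set L) \<inter> B = {}"
      then obtain x where x: "x \<in> sgen G (m_inv G ` set L)" "x \<in> A" by auto
      have c: "set L \<subseteq> carrier G" by (rule set_block[OF L])
      then have "inv x \<in> sgen G (m_inv G ` m_inv G ` set L)"
        by (intro inv_in_sgen x) auto
      also have "m_inv G ` m_inv G ` set L = set L"
        using c by (force simp: image_image)
      finally show False using assms[OF x(2)] E by auto
    qed
  qed simp
  finally show ?thesis .
qed

lemma hit_mono_set: "A \<subseteq> B \<Longrightarrow> hit n l A \<le> hit n l B"
  unfolding hit_def by (rule measure_pmf.finite_measure_mono) auto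

lemma hit_le_union:
  "hit n l A \<le> measure_pmf.prob (block l n) {L'. sgen G (S \<union> set L') \<inter> A \<noteq> {}}"
  unfolding hit_def by (rule measure_pmf.finite_measure_mono) (auto dest: sgen_Un2[where A = S])

lemma hit_drop: "hit (n + k) l A \<le> hit n (k + l) A"
proof -
  have "hit (n + k) l A = measure_pmf.expectation (block k n) (\<lambda>_. hit (n + k) l A)" by simp
  also have "\<dots> \<le> hit n (k + l) A"
    unfolding hit_add
    by (rule expectation_mono_pmf[where B = 1 and C = 1])
       (auto simp: hit_bounds hit_le_union)
  finally show ?thesis .
qed

lemma hit_take: "hit n k A \<le> hit n (k + l) A"
proof -
  have "hit n k A = measure_pmf.expectation (block k n) (indicator {L. sgen G (set L) \<inter> A \<noteq> {}})"
    by (simp add: hit_def)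
  also have "\<dots> \<le> hit n (k + l) A"
    unfolding hit_add
  proof (rule expectation_mono_pmf[where B = 1 and C = 1])
    fix L
    show "indicator {L. sgen G (set L) \<inter> A \<noteq> {}} L \<le>
      measure_pmf.prob (block l (n + k)) {L'. sgen G (set L \<union> set L') \<inter> A \<noteq> {}}"
    proof (cases "sgen G (set L) \<inter> A = {}")
      case False
      then have "sgen G (set L \<union> set L') \<inter> A \<noteq> {}" for L'
        using sgen_mono[of "set L" "set L \<union> set L'" _ G] by blast
      then have "{L'. sgen G (set L \<union> set L') \<inter> A \<noteq> {}} = UNIV" by auto
      then show ?thesis by (simp add: indicator_def)
    qed simp
  qed (auto simp: indicator_def)
  finally show ?thesis .
qed

lemma hit_mono: "k \<le> l \<Longrightarrow> hit n k A \<le> hit n l A"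
  using hit_take[of n k A "l - k"] by simp

lemma hit_surelyI:
  assumes "\<And>n \<epsilon>. 0 < \<epsilon> \<Longrightarrow> \<exists>l. 1 - \<epsilon> \<le> hit n l A"
  shows "hit_surely A"
  unfolding hit_surely_def
proof (intro allI LIMSEQ_I)
  fix n and r :: real assume "0 < r"
  with assms[of "r/2" n] obtain l where "1 - r / 2 \<le> hit n l A" by auto
  then have "norm (hit n k A - 1) < r" if "l \<le> k" for k
    using hit_mono[OF that, of n A] hit_bounds(2)[of n k A] \<open>0 < r\<close> by (auto simp: abs_if)
  then show "\<exists>no. \<forall>k\<ge>no. norm (hit n k A - 1) < r" by blast
qed

text \<open>The second target may depend on the element \<open>a\<close> found in the first block,
  as the later block is independent of it. The speed of the second hit may vary with
  \<open>a\<close>; dominated convergence over the first block replaces a uniform bound.\<close>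

lemma hit_surely_chain:
  assumes A: "hit_surely A"
    and B: "\<And>a. a \<in> A \<Longrightarrow> \<exists>B. hit_surely B \<and> (\<forall>b\<in>B. sgen G {a, b} \<inter> C \<noteq> {})"
  shows "hit_surely C"
proof (rule hit_surelyI)
  fix n and \<epsilon> :: real assume e: "0 < \<epsilon>"
  let ?T = "{L. sgen G (set L) \<inter> A \<noteq> {}}"
  from B obtain D where D: "\<And>a. a \<in> A \<Longrightarrow> hit_surely (D a)"
    "\<And>a b. a \<in> A \<Longrightarrow> b \<in> D a \<Longrightarrow> sgen G {a, b} \<inter> C \<noteq> {}" by metis
  define sel where "sel L = (SOME a. a \<in> sgen G (set L) \<inter> A)" for L
  have sel: "sel L \<in> sgen G (set L)" "sel L \<in> A" if "L \<in> ?T" for L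
    using someI_ex[of "\<lambda>a. a \<in> sgen G (set L) \<inter> A"] that by (auto simp: sel_def)
  from A have "(\<lambda>l. hit n l A) \<longlonglongrightarrow> 1" by (simp add: hit_surely_def)
  then have "eventually (\<lambda>l. 1 - \<epsilon> / 2 < hit n l A) sequentially"
    by (rule order_tendstoD) (use e in simp)
  then obtain k where k: "1 - \<epsilon> / 2 < hit n k A" by (auto simp: eventually_sequentially)
  have "(\<lambda>l. measure_pmf.expectation (block k n) (\<lambda>L. indicator ?T L * hit (n + k) l (D (sel L))))
      \<longlonglongrightarrow> measure_pmf.expectation (block k n) (indicator ?T)"
  proof (rule expectation_tendsto_pmf[where B = 1])
    fix L show "(\<lambda>l. indicator ?T L * hit (n + k) l (D (sel L))) \<longlonglongrightarrow> indicator ?T L"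
      using D(1)[OF sel(2), of L] by (cases "L \<in> ?T") (auto simp: hit_surely_def)
  qed (auto simp: indicator_def hit_bounds)
  also have "measure_pmf.expectation (block k n) (indicator ?T) = hit n k A" by (simp add: hit_def)
  finally have "eventually (\<lambda>l. hit n k A - \<epsilon> / 2 <
     measure_pmf.expectation (block k n) (\<lambda>L. indicator ?T L * hit (n + k) l (D (sel L)))) sequentially"
    by (rule order_tendstoD) (use e in simp)
  then obtain l where l: "hit n k A - \<epsilon> / 2 <
     measure_pmf.expectation (block k n) (\<lambda>L. indicator ?T L * hit (n + k) l (D (sel L)))"
    by (auto simp: eventually_sequentially)
  also have "\<dots> \<le> hit n (k + l) C"
    unfolding hit_add
  proof (rule expectation_mono_pmf[where B = 1 and C = 1])
    fix L
    show "indicator ?T L * hit (n + k) l (D (sel L)) \<le>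
      measure_pmf.prob (block l (n + k)) {L'. sgen G (set L \<union> set L') \<inter> C \<noteq> {}}"
    proof (cases "L \<in> ?T")
      case True
      have "sgen G (set L \<union> set L') \<inter> C \<noteq> {}" if b: "b \<in> sgen G (set L')" "b \<in> D (sel L)" for b L'
      proof -
        have "{sel L, b} \<subseteq> sgen G (set L \<union> set L')"
          using sel(1)[OF True] b(1) by (auto intro: sgen_Un1 sgen_Un2)
        moreover obtain c where "c \<in> sgen G {sel L, b}" "c \<in> C"
          using D(2)[OF sel(2)[OF True] b(2)] by blast
        ultimately show ?thesis using sgen_idem by (metis disjoint_iff)
      qed
      then have "{L'. sgen G (set L') \<inter> D (sel L) \<noteq> {}} \<subseteq> {L'. sgen G (set L \<union> set L') \<inter> C \<noteq> {}}"
        by blast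
      then show ?thesis using True
        by (simp add: hit_def measure_pmf.finite_measure_mono)
    qed simp
  qed (auto simp: indicator_def hit_bounds)
  finally show "\<exists>l. 1 - \<epsilon> \<le> hit n l C" using k by (intro exI[of _ "k + l"]) auto
qed

text \<open>Failure on the long block forces failure on both of its parts, which are
  independent.\<close>

lemma hit_fail_add: "1 - hit n (k + l) A \<le> (1 - hit n k A) * (1 - hit (n + k) l A)"
proof -
  let ?T = "{L. sgen G (set L) \<inter> A \<noteq> {}}"
  let ?p = "hit (n + k) l A"
  \<comment> \<open>The integrand is 1 where the first block already meets \<open>A\<close>, and
    \<open>?p\<close> elsewhere.\<close>
  have "hit n k A + (1 - hit n k A) * ?p =
     measure_pmf.expectation (block k n) (\<lambda>L. ?p + indicator ?T L * (1 - ?p))"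
  proof (subst Bochner_Integration.integral_add)
    show "integrable (measure_pmf (block k n)) (\<lambda>L. indicator ?T L * (1 - ?p))"
      by (rule integrable_pmf_bounded[where B = 1]) (auto simp: indicator_def hit_bounds)
  next
    have "measure_pmf.expectation (block k n) (\<lambda>L. indicator ?T L * (1 - ?p)) = hit n k A * (1 - ?p)"
      by (simp add: hit_def)
    then show "hit n k A + (1 - hit n k A) * ?p = measure_pmf.expectation (block k n) (\<lambda>_. ?p) +
        measure_pmf.expectation (block k n) (\<lambda>L. indicator ?T L * (1 - ?p))"
      by (simp add: algebra_simps)
  qed simp
  also have "\<dots> \<le> hit n (k + l) A"
    unfolding hit_add
  proof (rule expectation_mono_pmf[where B = 1 and C = 1])
    fix L
    show "?p + indicator ?T L * (1 - ?p) \<le>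
      measure_pmf.prob (block l (n + k)) {L'. sgen G (set L \<union> set L') \<inter> A \<noteq> {}}"
    proof (cases "L \<in> ?T")
      case True
      then have "sgen G (set L \<union> set L') \<inter> A \<noteq> {}" for L'
        using sgen_mono[of "set L" "set L \<union> set L'" _ G] by blast
      then have "{L'. sgen G (set L \<union> set L') \<inter> A \<noteq> {}} = UNIV" by auto
      then show ?thesis using True by simp
    next
      case False
      then show ?thesis by (simp add: hit_le_union)
    qed
  qed (auto simp: indicator_def hit_bounds)
  finally show ?thesis by (simp add: algebra_simps)
qed

text \<open>Disjoint blocks are independent, so a uniform lower bound amplifies to probability 1.\<close>
lemma hit_surely_if_bounded_below:
  assumes "0 < \<delta>" and low: "\<And>n. \<exists>l. \<delta> \<le> hit n l A"
  shows "hit_surely A"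
proof (rule hit_surelyI)
  fix n and \<epsilon> :: real assume e: "0 < \<epsilon>"
  have d1: "\<delta> \<le> 1" using low[of 0] hit_bounds(2) order_trans by blast
  have *: "\<exists>l. 1 - hit n l A \<le> (1 - \<delta>) ^ s" for s
  proof (induction s)
    case 0
    then show ?case by (auto intro: hit_bounds)
  next
    case (Suc s)
    then obtain k where k: "1 - hit n k A \<le> (1 - \<delta>) ^ s" by auto
    obtain l where l: "\<delta> \<le> hit (n + k) l A" using low by auto
    have "(1 - hit n k A) * (1 - hit (n + k) l A) \<le> (1 - \<delta>) ^ s * (1 - \<delta>)"
      using k l d1 hit_bounds by (intro mult_mono) (auto simp: hit_bounds)
    with hit_fail_add[of n k l A] show ?case by (intro exI[of _ "k + l"]) (simp add: mult.commute)
  qed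
  have "(\<lambda>s. (1 - \<delta>) ^ s) \<longlonglongrightarrow> 0" using assms(1) d1 by (intro LIMSEQ_power_zero) auto
  then have "eventually (\<lambda>s. (1 - \<delta>) ^ s < \<epsilon>) sequentially" by (rule order_tendstoD) (use e in simp)
  then obtain s where "(1 - \<delta>) ^ s < \<epsilon>" by (auto simp: eventually_sequentially)
  moreover obtain l where "1 - hit n l A \<le> (1 - \<delta>) ^ s" using *[of s] by blast
  ultimately show "\<exists>l. 1 - \<epsilon> \<le> hit n l A" by (intro exI[of _ l]) simp
qed

section \<open>Meeting every coset of a subgroup\<close>

text \<open>The target is the left coset of \<open>H\<close> by the inverse of \<open>x\<close>. In
  this form it says that any \<open>x\<close> can be corrected into \<open>H\<close> by a right
  factor from the semigroup.\<close>

definition cosets_hit_surely :: "'a set \<Rightarrow> bool" where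
  "cosets_hit_surely H \<longleftrightarrow> (\<forall>x\<in>carrier G. hit_surely {y \<in> carrier G. x \<otimes> y \<in> H})"

lemma hit_Suc:
  "hit n (Suc l) A = measure_pmf.expectation (\<nu> n)
     (\<lambda>x. measure_pmf.prob (block l (Suc n)) {L. sgen G (insert x (set L)) \<inter> A \<noteq> {}})"
  unfolding hit_def block.simps prob_bind_pmf by (simp add: vimage_def)

text \<open>For independent \<open>x \<sim> \<nu> j\<close> and a later block \<open>L\<close>, multiply \<open>x\<close> by some
  \<open>t\<close> of the semigroup of \<open>L\<close> in the coset \<open>x\<inverse> H\<close>. As \<open>t\<close> depends on
  \<open>x\<close> only through that coset, the law of \<open>x t \<in> H\<close> inherits almost invariance under
  left translations by \<open>H\<close>. One of the \<open>A i\<close> is hit with probability of order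
  \<open>1 / card I\<close>, hence so is its translate; inverting all random elements, which preserves
  their joint law, moves the inverse of a set into its place.\<close>
lemma hit_surely_if_shifts_cover:
  assumes H: "subgroup H G" and rec: "cosets_hit_surely H"
    and I: "finite I" and cover: "H \<subseteq> (\<Union>i\<in>I. A i)"
    and shift: "\<And>i. i \<in> I \<Longrightarrow> \<exists>h\<in>H. (\<forall>a \<in> A i \<inter> H. h \<otimes> a \<in> C) \<or> (\<forall>a \<in> A i \<inter> H. inv (h \<otimes> a) \<in> C)"
  shows "hit_surely C"
proof -
  interpret H: subgroup H G by (rule H)
  define r where "r = real (card I)"
  have "I \<noteq> {}" using cover H.one_closed by blast
  then have r: "0 < r" using I by (simp add: r_def card_gt_0_iff)
  from shift obtain h where h: "\<And>i. i \<in> I \<Longrightarrow> h i \<in> H"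
    "\<And>i. i \<in> I \<Longrightarrow> (\<forall>a \<in> A i \<inter> H. h i \<otimes> a \<in> C) \<or> (\<forall>a \<in> A i \<inter> H. inv (h i \<otimes> a) \<in> C)"
    by metis
  have "\<exists>l. 1 / (2 * r) \<le> hit n l C" for n
  proof -
    \<comment> \<open>Total mass 3/4 shared by \<open>r\<close> pieces leaves some piece 3/(4r); the
      translation costs 1/(4r), and 1/(2r) remains.\<close>
    have "eventually (\<lambda>j. \<forall>i\<in>I. shift_close G (\<nu> j) (h i) (1 / (4 * r))) sequentially"
      using h(1) r by (intro eventually_ball_finite I) (auto intro!: asymp_inv)
    then obtain j where j: "n \<le> j" "\<And>i. i \<in> I \<Longrightarrow> shift_close G (\<nu> j) (h i) (1 / (4 * r))"
      unfolding eventually_sequentially by (meson nle_le)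
    define D where "D x = {y \<in> carrier G. x \<otimes> y \<in> H}" for x
    have carr: "x \<in> carrier G" if "x \<in> set_pmf (\<nu> j)" for x using supp that by auto
    have "(\<lambda>l. measure_pmf.expectation (\<nu> j) (\<lambda>x. hit (Suc j) l (D x)))
        \<longlonglongrightarrow> measure_pmf.expectation (\<nu> j) (\<lambda>x. 1)"
      using rec carr
      by (intro expectation_tendsto_pmf[where B = 1])
         (auto simp: hit_bounds cosets_hit_surely_def hit_surely_def D_def)
    then have "eventually (\<lambda>l. 3 / 4 < measure_pmf.expectation (\<nu> j) (\<lambda>x. hit (Suc j) l (D x))) sequentially"
      by (rule order_tendstoD) simp
    then obtain l where l: "3 / 4 < measure_pmf.expectation (\<nu> j) (\<lambda>x. hit (Suc j) l (D x))"
      by (auto simp: eventually_sequentially)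
    \<comment> \<open>The choice sees \<open>x\<close> only through \<open>D x\<close>, which does
      not change when \<open>x\<close> is multiplied on the left by an element of \<open>H\<close>.
      Hence \<open>t\<close> survives the translation below.\<close>
    define t where "t x L = (SOME y. y \<in> sgen G (set L) \<inter> D x)" for x L
    define f where "f B x = measure_pmf.prob (block l (Suc j))
      {L. sgen G (set L) \<inter> D x \<noteq> {} \<and> x \<otimes> t x L \<in> B}" for B x
    define w where "w B = measure_pmf.expectation (\<nu> j) (f B)" for B
    have t: "t x L \<in> sgen G (set L)" "t x L \<in> carrier G" "x \<otimes> t x L \<in> H"
      if "sgen G (set L) \<inter> D x \<noteq> {}" for x L
      using someI_ex[of "\<lambda>y. y \<in> sgen G (set L) \<inter> D x"] that by (auto simp: t_def D_def)
    have f01: "0 \<le> f B x \<and> f B x \<le> 1" "\<bar>f B x\<bar> \<le> 1" for B x by (auto simp: f_def)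
    have "3 / 4 < (\<Sum>i\<in>I. w (A i \<inter> H))"
    proof -
      note l
      also have "measure_pmf.expectation (\<nu> j) (\<lambda>x. hit (Suc j) l (D x))
          \<le> measure_pmf.expectation (\<nu> j) (\<lambda>x. \<Sum>i\<in>I. f (A i \<inter> H) x)"
      proof (rule expectation_mono_pmf[where B = 1 and C = r])
        fix x assume "x \<in> set_pmf (\<nu> j)"
        have "hit (Suc j) l (D x) \<le> measure_pmf.prob (block l (Suc j))
            (\<Union>i\<in>I. {L. sgen G (set L) \<inter> D x \<noteq> {} \<and> x \<otimes> t x L \<in> A i \<inter> H})"
          unfolding hit_def
        proof (intro measure_pmf.finite_measure_mono subsetI)
          fix L assume "L \<in> {L. sgen G (set L) \<inter> D x \<noteq> {}}"
          then have L: "sgen G (set L) \<inter> D x \<noteq> {}" by simp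
          from t(3)[OF L] cover obtain i where "i \<in> I" "x \<otimes> t x L \<in> A i \<inter> H" by blast
          with L show "L \<in> (\<Union>i\<in>I. {L. sgen G (set L) \<inter> D x \<noteq> {} \<and> x \<otimes> t x L \<in> A i \<inter> H})"
            by blast
        qed simp
        also have "\<dots> \<le> (\<Sum>i\<in>I. f (A i \<inter> H) x)"
          unfolding f_def by (rule measure_pmf.finite_measure_subadditive_finite) (auto simp: I)
        finally show "hit (Suc j) l (D x) \<le> (\<Sum>i\<in>I. f (A i \<inter> H) x)" .
        have "(\<Sum>i\<in>I. f (A i \<inter> H) x) \<le> (\<Sum>i\<in>I. 1)" using f01 by (intro sum_mono) auto
        then show "\<bar>\<Sum>i\<in>I. f (A i \<inter> H) x\<bar> \<le> r"
          using f01 by (simp add: r_def sum_nonneg)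
      qed (simp add: hit_bounds)
      also have "\<dots> = (\<Sum>i\<in>I. w (A i \<inter> H))"
        unfolding w_def by (intro Bochner_Integration.integral_sum integrable_pmf_bounded[where B = 1] f01)
      finally show ?thesis .
    qed
    moreover have "(\<Sum>i\<in>I. 3 / (4 * r)) = 3 / 4" using r by (simp add: r_def)
    ultimately obtain i where i: "i \<in> I" "3 / (4 * r) < w (A i \<inter> H)"
      using sum_mono[of I "\<lambda>i. w (A i \<inter> H)" "\<lambda>i. 3 / (4 * r)"] by force
    define B where "B = (\<lambda>a. h i \<otimes> a) ` (A i \<inter> H)"
    have hi: "h i \<in> H" "h i \<in> carrier G" using h(1) i(1) by auto
    have "w (A i \<inter> H) \<le> measure_pmf.expectation (\<nu> j) (\<lambda>x. f B (h i \<otimes> x))"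
      unfolding w_def
    proof (rule expectation_mono_pmf[where B = 1 and C = 1])
      fix x assume "x \<in> set_pmf (\<nu> j)"
      then have x: "x \<in> carrier G" by (rule carr)
      have "h i \<otimes> z \<in> H \<longleftrightarrow> z \<in> H" if "z \<in> carrier G" for z
        using hi that by (metis H.m_closed H.m_inv_closed inv_solve_left' m_closed)
      then have D: "D (h i \<otimes> x) = D x"
        using hi x by (auto simp: D_def m_assoc)
      then have T: "t (h i \<otimes> x) L = t x L" for L by (simp add: t_def)
      have "h i \<otimes> x \<otimes> t (h i \<otimes> x) L \<in> B"
        if "sgen G (set L) \<inter> D x \<noteq> {}" "x \<otimes> t x L \<in> A i \<inter> H" for L
        using that t(2)[OF that(1)] hi x by (auto simp: B_def T m_assoc)
      then show "f (A i \<inter> H) x \<le> f B (h i \<otimes> x)"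
        unfolding f_def D by (intro measure_pmf.finite_measure_mono) auto
    qed (rule f01)+
    also have "\<dots> \<le> w B + 1 / (4 * r)"
      using j(2)[OF i(1), unfolded shift_close_def, rule_format, of "f B", OF f01(1)]
      unfolding w_def by linarith
    finally have "1 / (2 * r) \<le> w B" using i(2) r by (simp add: field_simps)
    also have "w B \<le> hit j (Suc l) B"
      unfolding hit_Suc w_def
    proof (rule expectation_mono_pmf[where B = 1 and C = 1])
      fix x assume "x \<in> set_pmf (\<nu> j)"
      have "x \<otimes> t x L \<in> sgen G (insert x (set L))" if "sgen G (set L) \<inter> D x \<noteq> {}" for L
        using t(1)[OF that] sgen_mono[of "set L" "insert x (set L)"]
        by (auto intro: sgen.intros)
      then show "f B x \<le> measure_pmf.prob (block l (Suc j)) {L. sgen G (insert x (set L)) \<inter> B \<noteq> {}}"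
        unfolding f_def by (intro measure_pmf.finite_measure_mono) auto
    qed (auto simp: f01)
    also have "\<dots> \<le> hit j (Suc l) C"
      using h(2)[OF i(1)]
    proof
      assume "\<forall>a\<in>A i \<inter> H. h i \<otimes> a \<in> C"
      then show ?thesis by (intro hit_mono_set) (auto simp: B_def)
    next
      assume "\<forall>a\<in>A i \<inter> H. inv (h i \<otimes> a) \<in> C"
      then show ?thesis by (intro hit_inv) (auto simp: B_def)
    qed
    \<comment> \<open>The index \<open>j\<close> was taken large for almost invariance; adding the
      draws from \<open>n\<close> to \<open>j - 1\<close> only enlarges the semigroup.\<close>
    also have "\<dots> \<le> hit n (j - n + Suc l) C"
      using hit_drop[of n "j - n" "Suc l" C] j(1) by simp
    finally show ?thesis by blast
  qed
  then show ?thesis using r by (intro hit_surely_if_bounded_below[of "1 / (2 * r)"]) auto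
qed

lemma cosets_hit_surely_carrier: "cosets_hit_surely (carrier G)"
  unfolding cosets_hit_surely_def
proof (intro ballI hit_surely_if_bounded_below[of 1] exI)
  fix x n assume x: "x \<in> carrier G"
  \<comment> \<open>One draw is required: the empty block generates the empty semigroup.\<close>
  have "hit n (Suc 0) {y \<in> carrier G. x \<otimes> y \<in> carrier G} = measure_pmf.expectation (\<nu> n) (\<lambda>x. 1)"
    unfolding hit_Suc
  proof (intro integral_cong_AE)
    show "AE y in measure_pmf (\<nu> n). measure_pmf.prob (block 0 (Suc n))
        {L. sgen G (insert y (set L)) \<inter> {y \<in> carrier G. x \<otimes> y \<in> carrier G} \<noteq> {}} = 1"
      unfolding AE_measure_pmf_iff
    proof
      fix y assume "y \<in> set_pmf (\<nu> n)"
      then have "y \<in> {y \<in> carrier G. x \<otimes> y \<in> carrier G}" using supp x by auto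
      then have "{L. sgen G (insert y (set L)) \<inter> {y \<in> carrier G. x \<otimes> y \<in> carrier G} \<noteq> {}} = UNIV"
        by (auto intro!: exI[of _ y] sgen.base)
      then show "measure_pmf.prob (block 0 (Suc n))
        {L. sgen G (insert y (set L)) \<inter> {y \<in> carrier G. x \<otimes> y \<in> carrier G} \<noteq> {}} = 1" by simp
    qed
  qed auto
  then show "1 \<le> hit n (Suc 0) {y \<in> carrier G. x \<otimes> y \<in> carrier G}" by simp
qed simp

text \<open>The pieces are the left cosets of \<open>H\<close>, described through inverses lying in
  right cosets. Left translation permutes them transitively even if \<open>H\<close> is not normal,
  so each piece can be moved onto the wanted coset.\<close>

lemma cosets_hit_surely_finite_index:
  assumes H: "subgroup H G" and fin: "finite (rcosets H)"
  shows "cosets_hit_surely H"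
  unfolding cosets_hit_surely_def
proof
  fix x assume x: "x \<in> carrier G"
  interpret H: subgroup H G by (rule H)
  show "hit_surely {y \<in> carrier G. x \<otimes> y \<in> H}"
  proof (rule hit_surely_if_shifts_cover[where H = "carrier G" and I = "rcosets H"
        and A = "\<lambda>R. {a \<in> carrier G. inv a \<in> R}"])
    show "carrier G \<subseteq> (\<Union>R\<in>rcosets H. {a \<in> carrier G. inv a \<in> R})"
    proof
      fix a assume a: "a \<in> carrier G"
      then have "inv a \<in> H #> inv a" "H #> inv a \<in> rcosets H"
        by (auto simp: rcos_self H rcosetsI[OF H.subset])
      with a show "a \<in> (\<Union>R\<in>rcosets H. {a \<in> carrier G. inv a \<in> R})" by auto
    qed
    fix R assume "R \<in> rcosets H"
    then obtain y where y: "y \<in> carrier G" "R = H #> y" by (auto simp: RCOSETS_def)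
    have "x \<otimes> (inv x \<otimes> y \<otimes> a) \<in> H" if "a \<in> carrier G" "inv a \<in> R" for a
    proof -
      from that y obtain k where k: "k \<in> H" "inv a = k \<otimes> y" by (auto simp: r_coset_def)
      then have "a = inv y \<otimes> inv k" using that y by (metis inv_inv inv_mult_group H.mem_carrier)
      then have "x \<otimes> (inv x \<otimes> y \<otimes> a) = inv k"
        using k y x by (simp add: m_assoc flip: m_assoc[of x "inv x"] m_assoc[of y "inv y"])
      then show ?thesis using k by simp
    qed
    then show "\<exists>h\<in>carrier G.
        (\<forall>a\<in>{a \<in> carrier G. inv a \<in> R} \<inter> carrier G. h \<otimes> a \<in> {y \<in> carrier G. x \<otimes> y \<in> H}) \<or>
        (\<forall>a\<in>{a \<in> carrier G. inv a \<in> R} \<inter> carrier G. inv (h \<otimes> a) \<in> {y \<in> carrier G. x \<otimes> y \<in> H})"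
      using x y by (intro bexI[of _ "inv x \<otimes> y"]) auto
  qed (use fin in \<open>auto simp: subgroup_self cosets_hit_surely_carrier\<close>)
qed

text \<open>The coset \<open>P i\<close> records the exponent \<open>i\<close> of \<open>g\<close>:
  products add exponents, inverses negate them. If the quotient is finite, different exponents may
  name the same coset, which does no harm.\<close>

lemma cosets_hit_surely_cyclic_step:
  assumes H: "subgroup H G" and K: "subgroup K G" and KH: "K \<subseteq> H"
    and norm: "\<And>x k. x \<in> H \<Longrightarrow> k \<in> K \<Longrightarrow> x \<otimes> k \<otimes> inv x \<in> K"
    and g: "g \<in> H" and gen: "\<And>x. x \<in> H \<Longrightarrow> \<exists>i::int. \<exists>k\<in>K. x = k \<otimes> g [^] i"
    and rec: "cosets_hit_surely H"
  shows "cosets_hit_surely K"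
proof -
  interpret H: subgroup H G by (rule H)
  interpret K: subgroup K G by (rule K)
  have gc: "g \<in> carrier G" using g by simp
  have gH: "g [^] i \<in> H" for i :: int using subgroup_int_pow_closed[OF H g] .
  define P where "P i = (\<lambda>k. k \<otimes> g [^] i) ` K" for i :: int
  have PH: "P i \<subseteq> H" for i using KH gH by (auto simp: P_def)
  have Pc: "P i \<subseteq> carrier G" for i using PH H.subset by blast
  have cover: "\<exists>i. x \<in> P i" if "x \<in> H" for x using gen[OF that] by (auto simp: P_def)
  have P_mult: "a \<otimes> b \<in> P (i + j)" if "a \<in> P i" "b \<in> P j" for a b i j
  proof -
    from that obtain k k' where k: "k \<in> K" "k' \<in> K" and ab: "a = k \<otimes> g [^] i" "b = k' \<otimes> g [^] j"
      by (auto simp: P_def)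
    have "a \<otimes> b = (k \<otimes> (g [^] i \<otimes> k' \<otimes> inv (g [^] i))) \<otimes> g [^] (i + j)"
      using k gc by (simp add: ab m_assoc int_pow_mult flip: m_assoc[of "inv _" "_ [^] _"])
    moreover have "k \<otimes> (g [^] i \<otimes> k' \<otimes> inv (g [^] i)) \<in> K" using norm[OF gH] k by auto
    ultimately show ?thesis by (auto simp: P_def)
  qed
  have P_inv: "inv a \<in> P (- i)" if "a \<in> P i" for a i
  proof -
    from that obtain k where k: "k \<in> K" and a: "a = k \<otimes> g [^] i" by (auto simp: P_def)
    have "inv a = (g [^] (- i) \<otimes> inv k \<otimes> inv (g [^] (- i))) \<otimes> g [^] (- i)"
      using k gc by (simp add: a inv_mult_group m_assoc int_pow_neg)
    moreover have "g [^] (- i) \<otimes> inv k \<otimes> inv (g [^] (- i)) \<in> K" using norm[OF gH] k by auto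
    ultimately show ?thesis by (auto simp: P_def)
  qed
  have P_gen: "g [^] i \<in> P i" for i
    using gc by (auto simp: P_def intro!: image_eqI[of _ _ \<one>])
  have P_0: "P 0 = K" using gc by (auto simp: P_def image_iff)
  have P_pow: "a [^] s \<in> P (int s * i)" if a: "a \<in> P i" for a i and s :: nat
  proof (induction s)
    case 0
    then show ?case by (simp add: P_0)
  next
    case (Suc s)
    then show ?case using P_mult[OF Suc a] by (simp add: algebra_simps)
  qed
  \<comment> \<open>Half-progressions of cosets: the two signs are exchanged by inversion, so no order on the
    quotient is needed and finite and infinite cyclic quotients are treated alike.\<close>
  have progression: "hit_surely (\<Union>t::nat. P (c + \<sigma> * (int t * p)))"
    if p: "0 < p" and sg: "\<sigma> \<in> {1, -1}" for c p \<sigma> :: int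
  proof (rule hit_surely_if_shifts_cover[OF H rec, where I = "{0..<p} \<times> {1, -1}"
        and A = "\<lambda>(r, s). \<Union>t::nat. P (r + s * (int t * p))"])
    show "H \<subseteq> (\<Union>i\<in>{0..<p} \<times> {1, -1}. case i of (r, s) \<Rightarrow> \<Union>t::nat. P (r + s * (int t * p)))"
    proof
      fix x assume "x \<in> H"
      then obtain i where i: "x \<in> P i" using cover by auto
      define s :: int where "s = (if 0 \<le> i div p then 1 else -1)"
      \<comment> \<open>The sign of the quotient selects the half-progression, its absolute value
        the index \<open>t\<close>.\<close>
      have "i = i mod p + s * (int (nat \<bar>i div p\<bar>) * p)"
        by (auto simp: s_def)
      with i have "x \<in> P (i mod p + s * (int (nat \<bar>i div p\<bar>) * p))" by simp
      then have "x \<in> (\<Union>t::nat. P (i mod p + s * (int t * p)))" by blast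
      moreover have "(i mod p, s) \<in> {0..<p} \<times> {1, -1}" using p by (auto simp: s_def)
      ultimately show "x \<in> (\<Union>i\<in>{0..<p} \<times> {1, -1}. case i of (r, s) \<Rightarrow> \<Union>t::nat. P (r + s * (int t * p)))"
        by (intro UN_I[of "(i mod p, s)"]) simp_all
    qed
    fix i assume i: "i \<in> {0..<p} \<times> {1, -1::int}"
    obtain r s where rs: "i = (r, s)" by (cases i)
    let ?C = "\<Union>t::nat. P (c + \<sigma> * (int t * p))" and ?A = "\<Union>t::nat. P (r + s * (int t * p))"
    show "\<exists>h\<in>H. (\<forall>a\<in>(case i of (r, s) \<Rightarrow> \<Union>t::nat. P (r + s * (int t * p))) \<inter> H. h \<otimes> a \<in> ?C) \<or>
        (\<forall>a\<in>(case i of (r, s) \<Rightarrow> \<Union>t::nat. P (r + s * (int t * p))) \<inter> H. inv (h \<otimes> a) \<in> ?C)"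
    proof (cases "s = \<sigma>")
      case True
      \<comment> \<open>Equal directions: the shift only moves the starting exponent from
        \<open>r\<close> to \<open>c\<close>.\<close>
      have "g [^] (c - r) \<otimes> a \<in> ?C" if "a \<in> ?A" for a
        using that P_mult[OF P_gen[of "c - r"]] True by fastforce
      then show ?thesis unfolding rs using gH by blast
    next
      case False
      then have s: "s = - \<sigma>" using sg i rs by auto
      \<comment> \<open>Opposite directions: the shift gives exponent
        \<open>- c - \<sigma> * (int t * p)\<close>, and inversion negates it.\<close>
      have "inv (g [^] (- c - r) \<otimes> a) \<in> ?C" if "a \<in> ?A" for a
      proof -
        from that obtain t :: nat where "a \<in> P (r + s * (int t * p))" by blast
        from P_inv[OF P_mult[OF P_gen[of "- c - r"] this]] s
        have "inv (g [^] (- c - r) \<otimes> a) \<in> P (c + \<sigma> * (int t * p))" by (simp add: add.commute)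
        then show ?thesis by blast
      qed
      then show ?thesis unfolding rs using gH by blast
    qed
  qed simp
  have coset: "hit_surely (P c)" for c
  \<comment> \<open>Starting at exponent 1 makes the exponent \<open>1 + t\<close> of
    \<open>a\<close> strictly positive, hence a legitimate period. The second progression descends
    from \<open>c\<close> with that period, and the missing multiple is supplied by \<open>s\<close>
    copies of \<open>a\<close>.\<close>
  proof (rule hit_surely_chain[OF progression[of 1 1 1]])
    fix a assume "a \<in> (\<Union>t::nat. P (1 + 1 * (int t * 1)))"
    then obtain t :: nat where a: "a \<in> P (1 + int t)" by auto
    show "\<exists>B. hit_surely B \<and> (\<forall>b\<in>B. sgen G {a, b} \<inter> P c \<noteq> {})"
    proof (intro exI conjI ballI)
      show "hit_surely (\<Union>s::nat. P (c + (- 1) * (int s * (1 + int t))))"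
        by (rule progression) auto
      fix b assume "b \<in> (\<Union>s::nat. P (c + (- 1) * (int s * (1 + int t))))"
      then obtain s :: nat where b: "b \<in> P (c + (- 1) * (int s * (1 + int t)))" by blast
      have "a [^] s \<otimes> b \<in> P c" using P_mult[OF P_pow[OF a, of s] b] by simp
      moreover have "a [^] s \<otimes> b \<in> sgen G {a, b}"
        by (rule pow_mult_in_sgen) (use a b Pc in blast)+
      ultimately show "sgen G {a, b} \<inter> P c \<noteq> {}" by blast
    qed
  qed auto
  show ?thesis
    unfolding cosets_hit_surely_def
  proof
    fix x assume x: "x \<in> carrier G"
    show "hit_surely {y \<in> carrier G. x \<otimes> y \<in> K}"
    proof (rule hit_surely_chain)
      show "hit_surely {y \<in> carrier G. x \<otimes> y \<in> H}" using rec x by (simp add: cosets_hit_surely_def)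
      fix a assume a: "a \<in> {y \<in> carrier G. x \<otimes> y \<in> H}"
      then obtain i where i: "x \<otimes> a \<in> P i" using cover by auto
      \<comment> \<open>Once \<open>x \<otimes> a\<close> lies in \<open>H\<close> with exponent
        \<open>i\<close>, a further element of exponent \<open>- i\<close> brings it into
        \<open>K\<close>.\<close>
      show "\<exists>B. hit_surely B \<and> (\<forall>b\<in>B. sgen G {a, b} \<inter> {y \<in> carrier G. x \<otimes> y \<in> K} \<noteq> {})"
      proof (intro exI conjI ballI)
        show "hit_surely (P (- i))" by (rule coset)
        fix b assume b: "b \<in> P (- i)"
        have "x \<otimes> (a \<otimes> b) \<in> K" using P_mult[OF i b] a b Pc x by (auto simp: P_0 m_assoc subset_iff)
        moreover have "a \<otimes> b \<in> carrier G" using a b Pc by blast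
        moreover have "a \<otimes> b \<in> sgen G {a, b}" by (auto intro: sgen.intros)
        ultimately show "sgen G {a, b} \<inter> {y \<in> carrier G. x \<otimes> y \<in> K} \<noteq> {}" by blast
      qed
    qed
  qed
qed

text \<open>The nested generated subgroups share multiplication, inverses and powers with
  \<open>G\<close>, so each cyclic factor can be treated inside \<open>G\<close> by lifting its
  generator to some \<open>g\<close>.\<close>

lemma cosets_hit_surely_polycyclic:
  assumes H: "subgroup H G" and poly: "polycyclic (subgroup_generated G H)"
    and rec: "cosets_hit_surely H"
  shows "cosets_hit_surely {\<one>}"
proof -
  let ?S = "subgroup_generated G H"
  interpret S: group ?S by simp
  from poly obtain Hs :: "nat \<Rightarrow> 'a set" and n where Hs: "Hs 0 = carrier ?S" "Hs n = {\<one>\<^bsub>?S\<^esub>}"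
    "\<And>i. i \<le> n \<Longrightarrow> subgroup (Hs i) ?S"
    "\<And>i. i < n \<Longrightarrow> Hs (Suc i) \<lhd> subgroup_generated ?S (Hs i)"
    "\<And>i. i < n \<Longrightarrow> cyclic_group (subgroup_generated ?S (Hs i) Mod Hs (Suc i))"
    unfolding polycyclic_def by auto
  have subG: "subgroup (Hs i) G" if "i \<le> n" for i
    using Hs(3)[OF that] by (simp add: subgroup_subgroup_generated_iff)
  have "cosets_hit_surely (Hs i)" if "i \<le> n" for i
    using that
  proof (induction i)
    case 0
    then show ?case using rec by (simp add: Hs(1) subgroup.carrier_subgroup_generated_subgroup[OF H])
  next
    case (Suc i)
    let ?K = "Hs (Suc i)" and ?T = "subgroup_generated ?S (Hs i)"
    have i: "i \<le> n" "i < n" using Suc.prems by auto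
    interpret N: normal ?K ?T by (rule Hs(4)[OF i(2)])
    interpret Hi: subgroup "Hs i" G by (rule subG[OF i(1)])
    interpret K: subgroup ?K G by (rule subG[OF Suc.prems])
    have T: "carrier ?T = Hs i" by (rule subgroup.carrier_subgroup_generated_subgroup[OF Hs(3)[OF i(1)]])
    have mult: "x \<otimes>\<^bsub>?T\<^esub> y = x \<otimes> y" for x y by simp
    have inv_T: "inv\<^bsub>?T\<^esub> x = inv x" if "x \<in> Hs i" for x
      using that T K.subset by (intro N.inv_equality) auto
    interpret Q: group "?T Mod ?K" by (rule N.factorgroup_is_group)
    obtain Y where Y: "Y \<in> carrier (?T Mod ?K)" "carrier (?T Mod ?K) = range (\<lambda>j::int. Y [^]\<^bsub>?T Mod ?K\<^esub> j)"
      using Hs(5)[OF i(2)] unfolding Q.cyclic_group by blast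
    obtain g where g: "g \<in> Hs i" "Y = ?K #>\<^bsub>?T\<^esub> g" using Y(1) by (auto simp: carrier_FactGroup T)
    show ?case
    proof (rule cosets_hit_surely_cyclic_step[OF Hi.subgroup_axioms K.subgroup_axioms _ _ g(1)])
      show "?K \<subseteq> Hs i" using N.subset T by simp
      show "x \<otimes> k \<otimes> inv x \<in> ?K" if "x \<in> Hs i" "k \<in> ?K" for x k
        using N.inv_op_closed2[of x k] that by (simp only: T mult inv_T)
      show "\<exists>j::int. \<exists>k\<in>?K. x = k \<otimes> g [^] j" if x: "x \<in> Hs i" for x
      proof -
        have "?K #>\<^bsub>?T\<^esub> x \<in> carrier (?T Mod ?K)" using x by (auto simp: carrier_FactGroup T)
        then obtain j :: int where "?K #>\<^bsub>?T\<^esub> x = Y [^]\<^bsub>?T Mod ?K\<^esub> j" using Y(2) by auto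
        also have "\<dots> = ?K #>\<^bsub>?T\<^esub> (g [^]\<^bsub>?T\<^esub> j)"
          unfolding g(2) using g(1) T by (intro N.FactGroup_int_pow) auto
        finally have "x \<in> ?K #>\<^bsub>?T\<^esub> (g [^]\<^bsub>?T\<^esub> j)"
          using N.rcos_self[of x ?K] x T N.subgroup_axioms by auto
        moreover have "g [^]\<^bsub>?T\<^esub> j = g [^] j"
          using g(1) T Hs(1) Hs(3)[OF i(1)] subgroup.subset[OF Hs(3)[OF i(1)]]
          by (subst S.int_pow_subgroup_generated) (auto intro!: int_pow_subgroup_generated)
        ultimately show ?thesis by (auto simp: r_coset_def)
      qed
    qed (rule Suc.IH[OF i(1)])
  qed
  from this[of n] show ?thesis by (simp add: Hs(2))
qed

theorem hit_surely_virtually_polycyclic: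
  assumes "virtually_polycyclic G" "x \<in> carrier G"
  shows "hit_surely {x}"
proof -
  from assms(1) obtain H where "subgroup H G" "finite (rcosets H)" "polycyclic (subgroup_generated G H)"
    by (auto simp: virtually_polycyclic_def)
  then have "cosets_hit_surely {\<one>}"
    by (intro cosets_hit_surely_polycyclic cosets_hit_surely_finite_index)
  then have "hit_surely {y \<in> carrier G. inv x \<otimes> y \<in> {\<one>}}"
    using assms(2) by (simp add: cosets_hit_surely_def)
  moreover have "{y \<in> carrier G. inv x \<otimes> y \<in> {\<one>}} = {x}"
    using assms(2) by (auto simp: inv_solve_left')
  ultimately show ?thesis by simp
qed

end

subsection \<open>The Liouville property and averaged convolution powers\<close>

text \<open>The law of the walk at time \<open>k\<close>, with the first step split off on the left
  to match the Markov property at time 1.\<close>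

primrec conv_pow :: "('a, 'b) monoid_scheme \<Rightarrow> 'a pmf \<Rightarrow> nat \<Rightarrow> 'a pmf" where
  "conv_pow G \<mu> 0 = return_pmf \<one>\<^bsub>G\<^esub>"
| "conv_pow G \<mu> (Suc k) = bind_pmf \<mu> (\<lambda>z. map_pmf (\<lambda>y. z \<otimes>\<^bsub>G\<^esub> y) (conv_pow G \<mu> k))"

text \<open>The position at a uniformly random time. Times start at 1, so that it is strictly in the
  future of the present position.\<close>

definition cesaro :: "('a, 'b) monoid_scheme \<Rightarrow> 'a pmf \<Rightarrow> nat \<Rightarrow> 'a pmf" where
  "cesaro G \<mu> N = bind_pmf (pmf_of_set {1..Suc N}) (conv_pow G \<mu>)"

lemma expectation_cesaro:
  fixes f :: "'a \<Rightarrow> real"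
  assumes "\<And>x. \<bar>f x\<bar> \<le> B"
  shows "measure_pmf.expectation (cesaro G \<mu> N) f =
    (\<Sum>k=1..Suc N. measure_pmf.expectation (conv_pow G \<mu> k) f) / real (Suc N)"
  unfolding cesaro_def by (simp add: expectation_bind_bounded[OF assms] integral_pmf_of_set del: conv_pow.simps)

context group
begin

lemma set_conv_pow:
  assumes "set_pmf \<mu> \<subseteq> carrier G"
  shows "set_pmf (conv_pow G \<mu> k) \<subseteq> carrier G"
  using assms by (induction k) auto

lemma set_cesaro:
  assumes "set_pmf \<mu> \<subseteq> carrier G"
  shows "set_pmf (cesaro G \<mu> N) \<subseteq> carrier G"
  using set_conv_pow[OF assms] by (auto simp: cesaro_def simp del: conv_pow.simps)

text \<open>Inversion turns a first step into a last one, so symmetry of the powers needs the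
  recursion from both ends.\<close>

lemma conv_pow_Suc_right:
  assumes "set_pmf \<mu> \<subseteq> carrier G"
  shows "conv_pow G \<mu> (Suc k) = bind_pmf (conv_pow G \<mu> k) (\<lambda>y. map_pmf (\<lambda>z. y \<otimes> z) \<mu>)"
proof (induction k)
  case 0
  have "map_pmf (\<lambda>z. z \<otimes> \<one>) \<mu> = map_pmf (\<lambda>z. \<one> \<otimes> z) \<mu>"
    by (intro map_pmf_cong) (use assms in auto)
  then show ?case by (simp add: bind_return_pmf map_pmf_def)
next
  case (Suc k)
  have "conv_pow G \<mu> (Suc (Suc k)) =
      bind_pmf \<mu> (\<lambda>z. bind_pmf (conv_pow G \<mu> k) (\<lambda>y. map_pmf (\<lambda>w. z \<otimes> (y \<otimes> w)) \<mu>))"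
    by (subst conv_pow.simps(2), subst Suc) (simp add: map_bind_pmf pmf.map_comp o_def)
  also have "\<dots> = bind_pmf \<mu> (\<lambda>z. bind_pmf (conv_pow G \<mu> k) (\<lambda>y. map_pmf (\<lambda>w. z \<otimes> y \<otimes> w) \<mu>))"
    by (intro bind_pmf_cong map_pmf_cong refl m_assoc[symmetric])
       (use assms set_conv_pow[OF assms, of k] in auto)
  also have "\<dots> = bind_pmf (conv_pow G \<mu> (Suc k)) (\<lambda>y. map_pmf (\<lambda>z. y \<otimes> z) \<mu>)"
    by (simp add: bind_assoc_pmf bind_map_pmf)
  finally show ?case .
qed

lemma map_inv_conv_pow:
  assumes "set_pmf \<mu> \<subseteq> carrier G" and sym: "map_pmf (m_inv G) \<mu> = \<mu>"
  shows "map_pmf (m_inv G) (conv_pow G \<mu> k) = conv_pow G \<mu> k"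
proof (induction k)
  case (Suc k)
  have "map_pmf (m_inv G) (conv_pow G \<mu> (Suc k)) =
      bind_pmf \<mu> (\<lambda>z. map_pmf (\<lambda>y. inv (z \<otimes> y)) (conv_pow G \<mu> k))"
    by (simp add: map_bind_pmf pmf.map_comp o_def)
  also have "\<dots> = bind_pmf \<mu> (\<lambda>z. map_pmf (\<lambda>y. inv y \<otimes> inv z) (conv_pow G \<mu> k))"
    by (intro bind_pmf_cong map_pmf_cong refl inv_mult_group)
       (use assms set_conv_pow[OF assms(1), of k] in auto)
  also have "\<dots> = bind_pmf (map_pmf (m_inv G) \<mu>)
      (\<lambda>z. map_pmf (\<lambda>y. y \<otimes> z) (map_pmf (m_inv G) (conv_pow G \<mu> k)))"
    by (simp add: bind_map_pmf pmf.map_comp o_def)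
  also have "\<dots> = bind_pmf \<mu> (\<lambda>z. map_pmf (\<lambda>y. y \<otimes> z) (conv_pow G \<mu> k))"
    by (simp only: sym Suc)
  also have "\<dots> = bind_pmf (conv_pow G \<mu> k) (\<lambda>y. map_pmf (\<lambda>z. y \<otimes> z) \<mu>)"
    unfolding map_pmf_def by (rule bind_commute_pmf)
  also have "\<dots> = conv_pow G \<mu> (Suc k)" by (rule conv_pow_Suc_right[OF assms(1), symmetric])
  finally show ?case .
qed simp

lemma map_inv_cesaro:
  assumes "set_pmf \<mu> \<subseteq> carrier G" "map_pmf (m_inv G) \<mu> = \<mu>"
  shows "map_pmf (m_inv G) (cesaro G \<mu> N) = cesaro G \<mu> N"
  by (simp add: cesaro_def map_bind_pmf map_inv_conv_pow[OF assms] del: conv_pow.simps)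

lemma map_inv_symmetric:
  assumes carr: "set_pmf \<mu> \<subseteq> carrier G" and sym: "symmetric_measure G \<mu>"
  shows "map_pmf (m_inv G) \<mu> = \<mu>"
proof (rule pmf_eqI)
  fix x
  have inj: "inj_on (m_inv G) (set_pmf \<mu>)" using inj_on_subset[OF inv_inj carr] .
  show "pmf (map_pmf (m_inv G) \<mu>) x = pmf \<mu> x"
  proof (cases "\<exists>y\<in>set_pmf \<mu>. x = inv y")
    case True
    then obtain y where y: "y \<in> set_pmf \<mu>" "x = inv y" by auto
    then show ?thesis
      using pmf_map_inj[OF inj y(1)] sym carr by (auto simp: symmetric_measure_def)
  next
    case False
    have "x \<notin> set_pmf \<mu>"
    proof
      assume x: "x \<in> set_pmf \<mu>"
      then have "inv x \<in> set_pmf \<mu>" using sym carr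
        by (metis set_pmf_iff subsetD symmetric_measure_def)
      then show False using False x carr by (metis inv_inv subsetD)
    qed
    with False have "x \<notin> set_pmf (map_pmf (m_inv G) \<mu>)" "x \<notin> set_pmf \<mu>" by auto
    then show ?thesis by (metis set_pmf_iff)
  qed
qed

text \<open>Elements are values of finite words over \<open>S\<close> and its inverses.\<close>

lemma countable_generate:
  assumes "countable S" "S \<subseteq> carrier G"
  shows "countable (generate G S)"
proof -
  define mm where "mm L = foldr (\<otimes>) L \<one>" for L
  have mm: "mm (L @ M) = mm L \<otimes> mm M" if "set L \<subseteq> carrier G" "set M \<subseteq> carrier G" for L M
  proof -
    have c: "mm L \<in> carrier G" if "set L \<subseteq> carrier G" for L
      using that by (induction L) (auto simp: mm_def)
    show ?thesis using that c by (induction L) (auto simp: mm_def m_assoc)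
  qed
  let ?S = "S \<union> m_inv G ` S"
  have "generate G S \<subseteq> mm ` lists ?S"
  proof
    fix x assume "x \<in> generate G S"
    then show "x \<in> mm ` lists ?S"
    proof (induction rule: generate.induct)
      case one
      show ?case by (intro image_eqI[of _ _ "[]"]) (auto simp: mm_def)
    next
      case (incl h)
      then show ?case using assms(2) by (intro image_eqI[of _ _ "[h]"]) (auto simp: mm_def)
    next
      case (inv h)
      then show ?case using assms(2) by (intro image_eqI[of _ _ "[inv h]"]) (auto simp: mm_def)
    next
      case (eng a b)
      then obtain L M where LM: "L \<in> lists ?S" "M \<in> lists ?S" "a = mm L" "b = mm M" by blast
      have "?S \<subseteq> carrier G" using assms(2) by auto
      with LM have "set L \<subseteq> carrier G" "set M \<subseteq> carrier G" by blast+
      with LM have "a \<otimes> b = mm (L @ M)" by (simp add: mm)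
      then show ?case using LM by (intro image_eqI[of _ _ "L @ M"]) auto
    qed
  qed
  moreover have "countable (mm ` lists ?S)" using assms by auto
  ultimately show ?thesis by (rule countable_subset)
qed

text \<open>An extra first step replaces each power by the next, so the two averages differ only by
  their end terms, both in [0, 1], divided by the number of terms.\<close>

lemma cesaro_almost_harmonic:
  fixes f :: "'a \<Rightarrow> real" and N :: nat
  assumes carr: "set_pmf \<mu> \<subseteq> carrier G" and f: "\<And>x. 0 \<le> f x \<and> f x \<le> 1" and x: "x \<in> carrier G"
  defines "u \<equiv> \<lambda>x. measure_pmf.expectation (cesaro G \<mu> N) (\<lambda>y. f (x \<otimes> y))"
  shows "\<bar>measure_pmf.expectation \<mu> (\<lambda>z. u (x \<otimes> z)) - u x\<bar> \<le> 1 / real (Suc N)"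
proof -
  define a where "a k = measure_pmf.expectation (conv_pow G \<mu> k) (\<lambda>y. f (x \<otimes> y))" for k
  have fB: "\<bar>f x\<bar> \<le> 1" for x using f[of x] by auto
  have u: "u x = (\<Sum>k=1..Suc N. measure_pmf.expectation (conv_pow G \<mu> k) (\<lambda>y. f (x \<otimes> y))) / real (Suc N)" for x
    unfolding u_def by (rule expectation_cesaro[where B = 1]) (rule fB)
  have shift: "measure_pmf.expectation \<mu> (\<lambda>z. measure_pmf.expectation (conv_pow G \<mu> k) (\<lambda>y. f (x \<otimes> z \<otimes> y))) = a (Suc k)" for k
  proof -
    have "a (Suc k) = measure_pmf.expectation \<mu> (\<lambda>z. measure_pmf.expectation (conv_pow G \<mu> k) (\<lambda>y. f (x \<otimes> (z \<otimes> y))))"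
      unfolding a_def conv_pow.simps by (subst expectation_bind_bounded[where B = 1]) (auto simp: fB)
    also have "\<dots> = measure_pmf.expectation \<mu> (\<lambda>z. measure_pmf.expectation (conv_pow G \<mu> k) (\<lambda>y. f (x \<otimes> z \<otimes> y)))"
      using carr set_conv_pow[OF carr, of k] x
      by (intro integral_cong_AE) (auto simp: AE_measure_pmf_iff m_assoc subset_iff intro!: integral_cong_AE)
    finally show ?thesis by simp
  qed
  have b: "\<bar>measure_pmf.expectation (conv_pow G \<mu> k) (\<lambda>y. f (w \<otimes> y))\<bar> \<le> 1" for k w
    using expectation_pmf_bounds[of "conv_pow G \<mu> k" "\<lambda>y. f (w \<otimes> y)"] f by auto
  have "measure_pmf.expectation \<mu> (\<lambda>z. u (x \<otimes> z)) = measure_pmf.expectation \<mu>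
      (\<lambda>z. \<Sum>k=1..Suc N. measure_pmf.expectation (conv_pow G \<mu> k) (\<lambda>y. f (x \<otimes> z \<otimes> y))) / real (Suc N)"
    unfolding u by (rule integral_divide_zero)
  also have "\<dots> = (\<Sum>k=1..Suc N. a (Suc k)) / real (Suc N)"
    unfolding shift[symmetric]
    by (subst Bochner_Integration.integral_sum) (rule integrable_pmf_bounded, rule b, rule refl)
  finally have "measure_pmf.expectation \<mu> (\<lambda>z. u (x \<otimes> z)) = (\<Sum>k=1..Suc N. a (Suc k)) / real (Suc N)" .
  moreover have "u x = (\<Sum>k=1..Suc N. a k) / real (Suc N)" by (simp only: u a_def)
  ultimately have "measure_pmf.expectation \<mu> (\<lambda>z. u (x \<otimes> z)) - u x = (\<Sum>k=1..Suc N. a (Suc k) - a k) / real (Suc N)"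
    by (simp only: sum_subtractf diff_divide_distrib)
  also have "(\<Sum>k=1..Suc N. a (Suc k) - a k) = a (Suc (Suc N)) - a 1"
    by (subst sum_Suc_diff) auto
  finally have *: "measure_pmf.expectation \<mu> (\<lambda>z. u (x \<otimes> z)) - u x = (a (Suc (Suc N)) - a 1) / real (Suc N)" .
  have "0 \<le> a k \<and> a k \<le> 1" for k unfolding a_def by (rule expectation_pmf_bounds) (rule f)
  from this[of 1] this[of "Suc (Suc N)"] have "\<bar>a (Suc (Suc N)) - a 1\<bar> \<le> 1" by linarith
  then show ?thesis unfolding * by (simp only: abs_divide) (simp add: divide_right_mono)
qed

text \<open>Were the translates by \<open>h\<close> to stay apart along a subsequence, a pointwise limit of
  the averaged test functions would be a bounded harmonic function separating \<open>h\<close> from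
  the identity.\<close>
lemma liouville_imp_cesaro_shift_close:
  assumes carr: "set_pmf \<mu> \<subseteq> carrier G" and cnt: "countable (carrier G)"
    and L: "liouville G \<mu>" and h: "h \<in> carrier G" and \<eta>: "0 < \<eta>"
  shows "eventually (\<lambda>N. shift_close G (cesaro G \<mu> N) h \<eta>) sequentially"
proof (rule ccontr)
  assume "\<not> ?thesis"
  then obtain r :: "nat \<Rightarrow> nat" where r: "strict_mono r" "\<And>n. \<not> shift_close G (cesaro G \<mu> (r n)) h \<eta>"
    using not_eventually_sequentiallyD by blast
  let ?E = "\<lambda>n. measure_pmf.expectation (cesaro G \<mu> (r n))"
  from r(2) have "\<forall>n. \<exists>f. (\<forall>x. 0 \<le> f x \<and> f x \<le> 1) \<and> \<eta> < \<bar>?E n (\<lambda>x. f (h \<otimes> x)) - ?E n f\<bar>"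
    unfolding shift_close_def by (meson not_le)
  then obtain f where f: "\<And>n x. 0 \<le> f n x \<and> f n x \<le> 1"
    and apart: "\<And>n. \<eta> < \<bar>?E n (\<lambda>x. f n (h \<otimes> x)) - ?E n (f n)\<bar>" by metis
  define u where "u n x = ?E n (\<lambda>y. f n (x \<otimes> y))" for n x
  have u01: "0 \<le> u n x \<and> u n x \<le> 1" for n x
    unfolding u_def by (rule expectation_pmf_bounds) (rule f)
  then have uB: "\<bar>u n x\<bar> \<le> 1" for n x by (simp add: abs_le_iff order_trans[of _ 0])
  \<comment> \<open>Countability of the carrier allows a diagonal subsequence converging at all
    points simultaneously.\<close>
  obtain k :: "nat \<Rightarrow> nat" where k: "strict_mono k" "\<And>x. x \<in> carrier G \<Longrightarrow> \<exists>l. (\<lambda>n. u (k n) x) \<longlonglongrightarrow> l"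
    using function_convergent_subsequence[OF cnt, of u 1] uB by auto
  define v where "v x = lim (\<lambda>n. u (k n) x)" for x
  have v: "(\<lambda>n. u (k n) x) \<longlonglongrightarrow> v x" if "x \<in> carrier G" for x
    using k(2)[OF that] by (auto simp: v_def limI)
  have "\<bar>v x\<bar> \<le> 1" if "x \<in> carrier G" for x
    using tendsto_rabs[OF v[OF that]] by (rule LIMSEQ_le_const2) (use uB in auto)
  moreover have "mu_harmonic G \<mu> v"
    unfolding mu_harmonic_def
  proof
    fix x assume x: "x \<in> carrier G"
    have "(\<lambda>n. measure_pmf.expectation \<mu> (\<lambda>z. u (k n) (x \<otimes> z))) \<longlonglongrightarrow> measure_pmf.expectation \<mu> (\<lambda>z. v (x \<otimes> z))"
      by (rule expectation_tendsto_pmf[where B = 1]) (use v x carr uB in auto)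
    then have "(\<lambda>n. measure_pmf.expectation \<mu> (\<lambda>z. u (k n) (x \<otimes> z)) - u (k n) x)
        \<longlonglongrightarrow> measure_pmf.expectation \<mu> (\<lambda>z. v (x \<otimes> z)) - v x"
      by (intro tendsto_diff v x)
    moreover have "(\<lambda>n. measure_pmf.expectation \<mu> (\<lambda>z. u (k n) (x \<otimes> z)) - u (k n) x) \<longlonglongrightarrow> 0"
    proof (rule Lim_null_comparison)
      have "\<bar>measure_pmf.expectation \<mu> (\<lambda>z. u (k n) (x \<otimes> z)) - u (k n) x\<bar> \<le> inverse (real (Suc n))" for n
      proof -
        have "n \<le> r (k n)" using k(1) r(1) by (meson order_trans seq_suble)
        have "\<bar>measure_pmf.expectation \<mu> (\<lambda>z. u (k n) (x \<otimes> z)) - u (k n) x\<bar> \<le> 1 / real (Suc (r (k n)))"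
          unfolding u_def by (rule cesaro_almost_harmonic[OF carr f x])
        also have "\<dots> \<le> inverse (real (Suc n))"
          using \<open>n \<le> r (k n)\<close> by (simp add: field_simps)
        finally show ?thesis .
      qed
      then show "eventually (\<lambda>n. norm (measure_pmf.expectation \<mu> (\<lambda>z. u (k n) (x \<otimes> z)) - u (k n) x)
          \<le> inverse (real (Suc n))) sequentially" by simp
      show "(\<lambda>n. inverse (real (Suc n))) \<longlonglongrightarrow> 0" by (rule LIMSEQ_inverse_real_of_nat)
    qed
    ultimately show "v x = measure_pmf.expectation \<mu> (\<lambda>z. v (x \<otimes> z))"
      using LIMSEQ_unique by fastforce
  qed
  ultimately have "v h = v \<one>" using L h unfolding liouville_def by blast
  moreover have "(\<lambda>n. \<bar>u (k n) h - u (k n) \<one>\<bar>) \<longlonglongrightarrow> \<bar>v h - v \<one>\<bar>"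
    by (intro tendsto_intros v h one_closed)
  moreover have "\<eta> \<le> \<bar>u (k n) h - u (k n) \<one>\<bar>" for n
  proof -
    have "u (k n) \<one> = ?E (k n) (f (k n))"
      unfolding u_def using set_cesaro[OF carr]
      by (intro integral_cong_AE) (auto simp: AE_measure_pmf_iff subset_iff)
    then show ?thesis using apart[of "k n"] by (simp add: u_def)
  qed
  ultimately have "\<eta> \<le> 0" using LIMSEQ_le_const[of _ "\<bar>v h - v \<one>\<bar>" \<eta>] by auto
  with \<eta> show False by simp
qed

end

subsection \<open>Comparison with the random walk\<close>

text \<open>Total variation distance between the joint laws of \<open>(x, x \<otimes> y)\<close> and
  \<open>(x, y)\<close> for independent \<open>x\<close> and \<open>y\<close>. The test function
  sees \<open>x\<close> too, because positions recorded earlier enter the later event.\<close>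

definition shift_close_on_average :: "('a, 'b) monoid_scheme \<Rightarrow> 'a pmf \<Rightarrow> 'a pmf \<Rightarrow> real \<Rightarrow> bool" where
  "shift_close_on_average G p q \<eta> \<longleftrightarrow> (\<forall>F. (\<forall>x y. 0 \<le> F x y \<and> F x y \<le> 1) \<longrightarrow>
     \<bar>measure_pmf.expectation p (\<lambda>x. measure_pmf.expectation q (\<lambda>y. F x (x \<otimes>\<^bsub>G\<^esub> y))) -
      measure_pmf.expectation p (\<lambda>x. measure_pmf.expectation q (F x))\<bar> \<le> \<eta>)"

text \<open>The rate of convergence may depend on \<open>x\<close>; dominated convergence under
  \<open>p\<close> suffices. Arguing by contradiction fixes one violating test function per index,
  so that there is a single sequence of integrands.\<close>

lemma shift_close_on_average_eventually:
  assumes p: "set_pmf p \<subseteq> C" and \<eta>: "0 < \<eta>"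
    and q: "\<And>h \<eta>. h \<in> C \<Longrightarrow> 0 < \<eta> \<Longrightarrow> eventually (\<lambda>N. shift_close G (q N) h \<eta>) sequentially"
  shows "eventually (\<lambda>N. shift_close_on_average G p (q N) \<eta>) sequentially"
proof (rule ccontr)
  assume "\<not> ?thesis"
  then obtain r :: "nat \<Rightarrow> nat" where r: "strict_mono r" "\<And>n. \<not> shift_close_on_average G p (q (r n)) \<eta>"
    using not_eventually_sequentiallyD by blast
  let ?E = "\<lambda>n. measure_pmf.expectation (q (r n))"
  from r(2) have "\<forall>n. \<exists>F. (\<forall>x y. 0 \<le> F x y \<and> F x y \<le> 1) \<and>
     \<eta> < \<bar>measure_pmf.expectation p (\<lambda>x. ?E n (\<lambda>y. F x (x \<otimes>\<^bsub>G\<^esub> y))) -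
      measure_pmf.expectation p (\<lambda>x. ?E n (F x))\<bar>"
    unfolding shift_close_on_average_def by (simp only: not_all not_imp not_le simp_thms)
  then obtain F where F: "\<And>n x y. 0 \<le> F n x y \<and> F n x y \<le> 1"
    and bad: "\<And>n. \<eta> < \<bar>measure_pmf.expectation p (\<lambda>x. ?E n (\<lambda>y. F n x (x \<otimes>\<^bsub>G\<^esub> y))) -
      measure_pmf.expectation p (\<lambda>x. ?E n (F n x))\<bar>" by (auto dest!: choice)
  define a where "a n x = ?E n (\<lambda>y. F n x (x \<otimes>\<^bsub>G\<^esub> y))" for n x
  define b where "b n x = ?E n (F n x)" for n x
  have a: "0 \<le> a n x \<and> a n x \<le> 1" for n x
    unfolding a_def by (rule expectation_pmf_bounds) (rule F)
  have b: "0 \<le> b n x \<and> b n x \<le> 1" for n x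
    unfolding b_def by (rule expectation_pmf_bounds) (rule F)
  have "(\<lambda>n. measure_pmf.expectation p (\<lambda>x. a n x - b n x)) \<longlonglongrightarrow> measure_pmf.expectation p (\<lambda>x. 0)"
  proof (rule expectation_tendsto_pmf[where B = 1])
    fix x assume "x \<in> set_pmf p"
    then have x: "x \<in> C" using p by auto
    show "(\<lambda>n. a n x - b n x) \<longlonglongrightarrow> 0"
    proof (rule tendstoI)
      fix e :: real assume e: "0 < e"
      have "eventually (\<lambda>n. shift_close G (q (r n)) x (e / 2)) sequentially"
        by (rule eventually_subseq[OF r(1) q[OF x]]) (use e in simp)
      then show "eventually (\<lambda>n. dist (a n x - b n x) 0 < e) sequentially"
      proof (rule eventually_mono)
        fix n assume "shift_close G (q (r n)) x (e / 2)"
        then have "\<bar>a n x - b n x\<bar> \<le> e / 2"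
          unfolding a_def b_def by (rule shift_close_def[THEN iffD1, rule_format]) (use F in auto)
        then show "dist (a n x - b n x) 0 < e" using e by simp
      qed
    qed
  next
    fix n x show "\<bar>a n x - b n x\<bar> \<le> 1" using a[of n x] b[of n x] by linarith
  qed
  moreover have "measure_pmf.expectation p (\<lambda>x. a n x - b n x) =
      measure_pmf.expectation p (a n) - measure_pmf.expectation p (b n)" for n
    using a b by (intro Bochner_Integration.integral_diff integrable_pmf_bounded[where B = 1]) auto
  ultimately have "(\<lambda>n. \<bar>measure_pmf.expectation p (a n) - measure_pmf.expectation p (b n)\<bar>) \<longlonglongrightarrow> 0"
    by (simp add: tendsto_rabs_zero)
  moreover have "\<eta> \<le> \<bar>measure_pmf.expectation p (a n) - measure_pmf.expectation p (b n)\<bar>" for n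
    using bad[of n] by (simp add: a_def[abs_def] b_def[abs_def])
  ultimately have "\<eta> \<le> 0" by (intro LIMSEQ_le_const[of _ 0 \<eta>]) auto
  with \<eta> show False by simp
qed

lemma shift_close_mono: "shift_close G \<nu> h \<eta> \<Longrightarrow> \<eta> \<le> \<eta>' \<Longrightarrow> shift_close G \<nu> h \<eta>'"
  unfolding shift_close_def by (meson order_trans)

lemma sgen_finitary: "x \<in> sgen G A \<Longrightarrow> \<exists>F. finite F \<and> F \<subseteq> A \<and> x \<in> sgen G F"
proof (induction rule: sgen.induct)
  case (base x)
  then show ?case by (intro exI[of _ "{x}"]) (auto intro: sgen.base)
next
  case (mult x y)
  then obtain F F' where "finite F" "F \<subseteq> A" "x \<in> sgen G F" "finite F'" "F' \<subseteq> A" "y \<in> sgen G F'" by blast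
  then show ?case
    by (intro exI[of _ "F \<union> F'"]) (auto intro: sgen.mult sgen_Un1 sgen_Un2)
qed

context group
begin

text \<open>Dependent choice, since how long to wait for \<open>\<nu> (Suc i)\<close> depends on
  \<open>\<nu> i\<close>. The law chosen at stage \<open>i\<close> is also almost invariant under
  the first \<open>i + 1\<close> enumerated elements with tolerance 1/(i+1), which gives invariance
  under each element in the limit. The start \<open>p0\<close> is left free for the law of the walk
  at a given time.\<close>

lemma asymptotically_invariant_sequence_exists:
  assumes carr: "set_pmf \<mu> \<subseteq> carrier G" and cnt: "countable (carrier G)"
    and sym: "map_pmf (m_inv G) \<mu> = \<mu>" and L: "liouville G \<mu>"
    and p0: "set_pmf p0 \<subseteq> carrier G" "map_pmf (m_inv G) p0 = p0"
    and \<epsilon>: "\<And>i. 0 < \<epsilon> i"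
  obtains \<nu> where "\<nu> 0 = p0" "asymptotically_invariant G \<nu>" "\<And>i. \<nu> (Suc i) \<in> range (cesaro G \<mu>)"
    "\<And>i. shift_close_on_average G (\<nu> i) (\<nu> (Suc i)) (\<epsilon> i)"
proof -
  define e where "e = from_nat_into (carrier G)"
  have e: "e l \<in> carrier G" for l unfolding e_def by (rule from_nat_into) auto
  define P where "P i p \<longleftrightarrow> set_pmf p \<subseteq> carrier G \<and> map_pmf (m_inv G) p = p \<and> (i = 0 \<longrightarrow> p = p0)" for i :: nat and p
  define Q where "Q i p q \<longleftrightarrow> q \<in> range (cesaro G \<mu>) \<and> shift_close_on_average G p q (\<epsilon> i) \<and>
    (\<forall>l\<le>i. shift_close G q (e l) (1 / real (Suc i)))" for i p q
  have "\<exists>\<nu>. \<forall>i. P i (\<nu> i) \<and> Q i (\<nu> i) (\<nu> (Suc i))"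
  proof (rule dependent_nat_choice)
    show "\<exists>p. P 0 p" using p0 by (auto simp: P_def)
    fix p i assume "P i p"
    then have p: "set_pmf p \<subseteq> carrier G" by (simp add: P_def)
    have close: "eventually (\<lambda>N. shift_close G (cesaro G \<mu> N) h \<eta>) sequentially"
      if "h \<in> carrier G" "0 < \<eta>" for h \<eta>
      using liouville_imp_cesaro_shift_close[OF carr cnt L that] .
    have "eventually (\<lambda>N. shift_close_on_average G p (cesaro G \<mu> N) (\<epsilon> i) \<and>
        (\<forall>l\<in>{..i}. shift_close G (cesaro G \<mu> N) (e l) (1 / real (Suc i)))) sequentially"
      by (intro eventually_conj eventually_ball_finite ballI close e
          shift_close_on_average_eventually[OF p \<epsilon>]) auto
    then obtain N where "shift_close_on_average G p (cesaro G \<mu> N) (\<epsilon> i) \<and>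
        (\<forall>l\<in>{..i}. shift_close G (cesaro G \<mu> N) (e l) (1 / real (Suc i)))"
      by (auto simp: eventually_sequentially)
    then show "\<exists>q. P (Suc i) q \<and> Q i p q"
      using set_cesaro[OF carr] map_inv_cesaro[OF carr sym]
      by (intro exI[of _ "cesaro G \<mu> N"]) (auto simp: P_def Q_def)
  qed
  then obtain \<nu> where \<nu>: "\<And>i. P i (\<nu> i)" "\<And>i. Q i (\<nu> i) (\<nu> (Suc i))" by blast
  have "asymptotically_invariant G \<nu>"
  proof unfold_locales
    fix h and \<eta> :: real assume h: "h \<in> carrier G" and "0 < \<eta>"
    obtain l where l: "h = e l" unfolding e_def using from_nat_into_surj[OF cnt h] by metis
    obtain n where n: "1 / real (Suc n) < \<eta>" using \<open>0 < \<eta>\<close> nat_approx_posE by blast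
    have "shift_close G (\<nu> i) h \<eta>" if i: "Suc (max l n) \<le> i" for i
    proof -
      obtain j where j: "i = Suc j" "l \<le> j" "n \<le> j" using i by (cases i) auto
      have "shift_close G (\<nu> i) h (1 / real (Suc j))" using \<nu>(2)[of j] j l by (auto simp: Q_def)
      moreover have "1 / real (Suc j) \<le> 1 / real (Suc n)" using j by (simp add: field_simps)
      ultimately show ?thesis using n by (auto elim: shift_close_mono)
    qed
    then show "eventually (\<lambda>i. shift_close G (\<nu> i) h \<eta>) sequentially"
      by (rule eventually_sequentiallyI)
  qed (use \<nu>(1) in \<open>auto simp: P_def\<close>)
  then show ?thesis using that[of \<nu>] \<nu> by (auto simp: P_def Q_def)
qed

end

section \<open>Reaching events of the walk and the Markov property\<close>

locale countable_group_walk = group G for G (structure) +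
  fixes \<mu> :: "'a pmf"
  assumes countable_carrier: "countable (carrier G)"
    and supp_\<mu>: "set_pmf \<mu> \<subseteq> carrier G"
begin

sublocale sequence_space "measure_pmf \<mu>" ..

abbreviation paths :: "(nat \<Rightarrow> 'a) measure" where "paths \<equiv> path_space \<mu>"

definition carrier_paths :: "(nat \<Rightarrow> 'a) set" where
  "carrier_paths = {\<omega>. \<forall>i. \<omega> i \<in> carrier G}"

text \<open>Over an uncountable type the group product need not be measurable for the product
  sigma-algebra, so all events are confined to the paths inside the countable carrier.\<close>
definition reaches :: "'a \<Rightarrow> nat \<Rightarrow> 'a set \<Rightarrow> 'a \<Rightarrow> (nat \<Rightarrow> 'a) set" where
  "reaches g n A x = {\<omega> \<in> carrier_paths. g \<in> sgen G (A \<union> {x \<otimes> rw_pos G \<omega> m | m. n \<le> m})}"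

text \<open>Here \<open>x\<close> is the present position and \<open>A\<close> collects positions
  already recorded; having both as parameters lets the Markov property be iterated.\<close>

definition reach_prob :: "'a \<Rightarrow> nat \<Rightarrow> 'a set \<Rightarrow> 'a \<Rightarrow> real" where
  "reach_prob g n A x = measure paths (reaches g n A x)"

sublocale paths: prob_space paths
  unfolding path_space_def by (rule P.prob_space_axioms)

lemma space_paths [simp]: "space paths = UNIV"
  by (simp add: path_space_def space_PiM)

lemma coordinate_sets: "{\<omega>. \<omega> i \<in> B} \<in> sets paths"
proof -
  have "(\<lambda>\<omega>. \<omega> i) \<in> measurable paths (measure_pmf \<mu>)"
    unfolding path_space_def by (rule measurable_component_singleton) simp
  from measurable_sets[OF this, of B] show ?thesis by (simp add: vimage_def)
qed

lemma carrier_paths_sets: "carrier_paths \<in> sets paths"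
proof -
  have "carrier_paths = (\<Inter>i. {\<omega>. \<omega> i \<in> carrier G})" by (auto simp: carrier_paths_def)
  then show ?thesis using coordinate_sets by auto
qed

lemma AE_carrier_paths: "AE \<omega> in paths. \<omega> \<in> carrier_paths"
proof -
  have "AE \<omega> in paths. \<omega> i \<in> carrier G" for i
    unfolding path_space_def
    by (rule AE_component) (use supp_\<mu> in \<open>auto simp: AE_measure_pmf_iff\<close>)
  then show ?thesis by (simp add: carrier_paths_def AE_all_countable)
qed

lemma rw_pos_closed: "\<omega> \<in> carrier_paths \<Longrightarrow> rw_pos G \<omega> m \<in> carrier G"
  by (induction m) (auto simp: carrier_paths_def)

lemma rw_pos_sets: "{\<omega> \<in> carrier_paths. rw_pos G \<omega> m = c} \<in> sets paths"
proof (induction m arbitrary: c)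
  case 0
  then show ?case using carrier_paths_sets by (cases "c = \<one>") auto
next
  case (Suc m)
  let ?D = "{(d, e) \<in> carrier G \<times> carrier G. d \<otimes> e = c}"
  have "{\<omega> \<in> carrier_paths. rw_pos G \<omega> (Suc m) = c} =
    (\<Union>p\<in>?D. {\<omega> \<in> carrier_paths. rw_pos G \<omega> m = fst p} \<inter> {\<omega>. \<omega> m \<in> {snd p}})"
    using rw_pos_closed by (auto simp: carrier_paths_def)
  moreover have "countable ?D"
    by (rule countable_subset[of _ "carrier G \<times> carrier G"]) (auto intro: countable_carrier)
  ultimately show ?case
    using sets.countable_UN''[of ?D, OF _ sets.Int[OF Suc coordinate_sets]] by (simp only:)
qed

text \<open>Only finitely many generators enter a product, and a countable carrier has countably
  many finite subsets, so the event is a countable union of conditions that finitely many points are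
  visited.\<close>

lemma reaches_sets: "reaches g n A x \<in> sets paths"
proof -
  let ?F = "{F \<in> {F. finite F \<and> F \<subseteq> carrier G}. g \<in> sgen G (A \<union> (\<lambda>y. x \<otimes> y) ` F)}"
  have "reaches g n A x = (\<Union>F\<in>?F. carrier_paths \<inter> (\<Inter>c\<in>F. \<Union>m\<in>{n..}. {\<omega> \<in> carrier_paths. rw_pos G \<omega> m = c}))"
    (is "?L = ?R")
  proof (intro equalityI subsetI)
    fix \<omega> assume "\<omega> \<in> ?L"
    moreover have "{x \<otimes> rw_pos G \<omega> m | m. n \<le> m} = (\<lambda>y. x \<otimes> y) ` rw_pos G \<omega> ` {n..}" by auto
    ultimately have \<omega>: "\<omega> \<in> carrier_paths" and "g \<in> sgen G (A \<union> (\<lambda>y. x \<otimes> y) ` rw_pos G \<omega> ` {n..})"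
      by (simp_all only: reaches_def mem_Collect_eq)
    then obtain E where E: "finite E" "E \<subseteq> A \<union> (\<lambda>y. x \<otimes> y) ` rw_pos G \<omega> ` {n..}" "g \<in> sgen G E"
      using sgen_finitary by metis
    have "finite (E - A)" "E - A \<subseteq> (\<lambda>y. x \<otimes> y) ` rw_pos G \<omega> ` {n..}" using E by auto
    then obtain F where F: "F \<subseteq> rw_pos G \<omega> ` {n..}" "finite F" "E - A = (\<lambda>y. x \<otimes> y) ` F"
      by (meson finite_subset_image)
    have "g \<in> sgen G (A \<union> (\<lambda>y. x \<otimes> y) ` F)"
      using sgen_mono[of E _ g] E(3) F(3) by blast
    moreover have "F \<subseteq> carrier G" using F(1) rw_pos_closed[OF \<omega>] by auto
    ultimately show "\<omega> \<in> ?R" using F \<omega> by blast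
  next
    fix \<omega> assume "\<omega> \<in> ?R"
    then obtain F where \<omega>: "\<omega> \<in> carrier_paths" and F: "g \<in> sgen G (A \<union> (\<lambda>y. x \<otimes> y) ` F)"
      "F \<subseteq> {rw_pos G \<omega> m | m. n \<le> m}" by fastforce
    from F(2) have "A \<union> (\<lambda>y. x \<otimes> y) ` F \<subseteq> A \<union> {x \<otimes> rw_pos G \<omega> m | m. n \<le> m}" by blast
    from sgen_mono[OF this F(1)] \<omega> show "\<omega> \<in> ?L" by (simp add: reaches_def)
  qed
  also have "\<dots> \<in> sets paths"
  proof (rule sets.countable_UN'')
    show "countable ?F"
      by (rule countable_subset[OF _ countable_Collect_finite_subset[OF countable_carrier]]) auto
    fix F assume "F \<in> ?F"
    then have "finite F" by simp
    then show "carrier_paths \<inter> (\<Inter>c\<in>F. \<Union>m\<in>{n..}. {\<omega> \<in> carrier_paths. rw_pos G \<omega> m = c}) \<in> sets paths"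
      using carrier_paths_sets rw_pos_sets
      by (cases "F = {}") (auto intro!: sets.Int sets.finite_INT sets.countable_UN'')
  qed
  finally show ?thesis .
qed

lemma reach_prob_bounds: "0 \<le> reach_prob g n A x \<and> reach_prob g n A x \<le> 1"
  by (simp add: reach_prob_def)

lemma reach_prob_abs_le: "\<bar>reach_prob g n A x\<bar> \<le> 1"
  using reach_prob_bounds[of g n A x] by simp

lemma reach_prob_mono: "A \<subseteq> B \<Longrightarrow> reach_prob g n A x \<le> reach_prob g n B x"
  unfolding reach_prob_def
  by (rule paths.finite_measure_mono[OF _ reaches_sets])
     (auto simp: reaches_def intro: sgen_mono[of "A \<union> _" "B \<union> _"])

lemma measure_paths_first_step:
  assumes "E \<in> sets paths"
  shows "measure paths E = measure_pmf.expectation \<mu> (\<lambda>s. measure paths {\<omega>. case_nat s \<omega> \<in> E})"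
proof -
  have E: "E \<in> sets S" using assms by (simp add: path_space_def)
  have f: "(\<lambda>(s, \<omega>). case_nat s \<omega>) \<in> measurable (measure_pmf \<mu> \<Otimes>\<^sub>M S) S" by measurable
  have "emeasure paths E = emeasure (distr (measure_pmf \<mu> \<Otimes>\<^sub>M S) S (\<lambda>(s, \<omega>). case_nat s \<omega>)) E"
    by (simp add: PiM_iter path_space_def)
  also have "\<dots> = emeasure (measure_pmf \<mu> \<Otimes>\<^sub>M S) ((\<lambda>(s, \<omega>). case_nat s \<omega>) -` E \<inter> space (measure_pmf \<mu> \<Otimes>\<^sub>M S))"
    by (rule emeasure_distr[OF f E])
  also have "\<dots> = (\<integral>\<^sup>+s. emeasure S (Pair s -` ((\<lambda>(s, \<omega>). case_nat s \<omega>) -` E \<inter> space (measure_pmf \<mu> \<Otimes>\<^sub>M S))) \<partial>measure_pmf \<mu>)"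
    by (rule P.emeasure_pair_measure_alt) (rule measurable_sets[OF f E])
  also have "\<dots> = (\<integral>\<^sup>+s. ennreal (measure paths {\<omega>. case_nat s \<omega> \<in> E}) \<partial>measure_pmf \<mu>)"
    by (intro nn_integral_cong)
       (simp add: vimage_def space_pair_measure space_PiM paths.emeasure_eq_measure[symmetric] path_space_def[symmetric])
  also have "\<dots> = ennreal (measure_pmf.expectation \<mu> (\<lambda>s. measure paths {\<omega>. case_nat s \<omega> \<in> E}))"
    by (rule nn_integral_eq_integral) (auto intro!: integrable_pmf_bounded[where B = 1])
  finally show ?thesis
    by (simp add: paths.emeasure_eq_measure integral_nonneg_AE)
qed

lemma rw_pos_case_nat:
  assumes "s \<in> carrier G" "\<omega> \<in> carrier_paths"
  shows "rw_pos G (case_nat s \<omega>) (Suc m) = s \<otimes> rw_pos G \<omega> m"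
proof (induction m)
  case (Suc m)
  have "\<omega> m \<in> carrier G" using assms(2) by (simp add: carrier_paths_def)
  then have "s \<otimes> rw_pos G \<omega> m \<otimes> \<omega> m = s \<otimes> rw_pos G \<omega> (Suc m)"
    using assms rw_pos_closed[OF assms(2), of m] by (simp add: m_assoc)
  with Suc show ?case by simp
qed (use assms in simp)

text \<open>After a first step \<open>s\<close> the remaining path is a fresh walk seen from
  \<open>x \<otimes> s\<close>, with the clock lowered by one.\<close>

lemma reach_prob_Suc:
  assumes x: "x \<in> carrier G"
  shows "reach_prob g (Suc n) A x = measure_pmf.expectation \<mu> (\<lambda>s. reach_prob g n A (x \<otimes> s))"
proof -
  have "{\<omega>. case_nat s \<omega> \<in> reaches g (Suc n) A x} = reaches g n A (x \<otimes> s)" if s: "s \<in> carrier G" for s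
  proof -
    have c: "case_nat s \<omega> \<in> carrier_paths \<longleftrightarrow> \<omega> \<in> carrier_paths" for \<omega>
      using s by (auto simp: carrier_paths_def split: nat.splits)
    have "{x \<otimes> rw_pos G (case_nat s \<omega>) m | m. Suc n \<le> m} = {x \<otimes> s \<otimes> rw_pos G \<omega> m | m. n \<le> m}"
      if \<omega>: "\<omega> \<in> carrier_paths" for \<omega>
    proof -
      have "{x \<otimes> rw_pos G (case_nat s \<omega>) m | m. Suc n \<le> m} = {x \<otimes> rw_pos G (case_nat s \<omega>) (Suc m) | m. n \<le> m}"
        by (metis Suc_le_D Suc_le_mono)
      also have "\<dots> = {x \<otimes> s \<otimes> rw_pos G \<omega> m | m. n \<le> m}"
        by (simp only: rw_pos_case_nat[OF s \<omega>] m_assoc[OF x s rw_pos_closed[OF \<omega>]])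
      finally show ?thesis .
    qed
    then show ?thesis by (auto simp: reaches_def c)
  qed
  then show ?thesis
    unfolding reach_prob_def
    using supp_\<mu> by (subst measure_paths_first_step[OF reaches_sets], intro integral_cong_AE) (auto simp: AE_measure_pmf_iff subset_iff)
qed

lemma reach_prob_0:
  assumes x: "x \<in> carrier G"
  shows "reach_prob g 0 A x = reach_prob g (Suc 0) (insert x A) x"
proof -
  have "{x \<otimes> rw_pos G \<omega> m | m. 0 \<le> m} = insert x {x \<otimes> rw_pos G \<omega> m | m. Suc 0 \<le> m}" for \<omega>
  proof -
    have "UNIV = insert 0 {Suc 0..}" by auto
    then have "{x \<otimes> rw_pos G \<omega> m | m. 0 \<le> m} = (\<lambda>m. x \<otimes> rw_pos G \<omega> m) ` insert 0 {Suc 0..}"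
      by (simp add: full_SetCompr_eq)
    also have "\<dots> = insert x {x \<otimes> rw_pos G \<omega> m | m. Suc 0 \<le> m}"
      using x by (auto simp: image_def)
    finally show ?thesis .
  qed
  then show ?thesis by (simp add: reach_prob_def reaches_def)
qed

text \<open>Recording only the position at time \<open>k + 1\<close> forgets those in between, which
  can only shrink the semigroup. The tail starts at \<open>Suc 0\<close> because the present
  position is stored in \<open>A\<close> if it is to count.\<close>

lemma reach_prob_conv_pow:
  assumes "x \<in> carrier G"
  shows "measure_pmf.expectation (conv_pow G \<mu> (Suc k)) (\<lambda>y. reach_prob g (Suc 0) (insert (x \<otimes> y) A) (x \<otimes> y))
    \<le> reach_prob g (Suc 0) A x"
  using assms
proof (induction k arbitrary: x A)
  case 0
  then show ?case
    unfolding conv_pow.simps reach_prob_Suc[OF 0]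
    using supp_\<mu>
    by (subst expectation_bind_bounded[where B = 1])
       (auto simp: reach_prob_abs_le reach_prob_0 AE_measure_pmf_iff subset_iff intro!: eq_refl integral_cong_AE)
next
  case (Suc k)
  let ?E = "measure_pmf.expectation (conv_pow G \<mu> (Suc k))"
  have "measure_pmf.expectation (conv_pow G \<mu> (Suc (Suc k))) (\<lambda>y. reach_prob g (Suc 0) (insert (x \<otimes> y) A) (x \<otimes> y))
     = measure_pmf.expectation \<mu> (\<lambda>s. ?E (\<lambda>y. reach_prob g (Suc 0) (insert (x \<otimes> (s \<otimes> y)) A) (x \<otimes> (s \<otimes> y))))"
    by (subst conv_pow.simps(2), subst expectation_bind_bounded[where B = 1])
       (auto simp: reach_prob_abs_le simp del: conv_pow.simps)
  also have "\<dots> \<le> measure_pmf.expectation \<mu> (\<lambda>s. reach_prob g 0 A (x \<otimes> s))"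
  proof (rule expectation_mono_pmf[where B = 1 and C = 1])
    fix s assume "s \<in> set_pmf \<mu>"
    then have s: "s \<in> carrier G" using supp_\<mu> by auto
    have "?E (\<lambda>y. reach_prob g (Suc 0) (insert (x \<otimes> (s \<otimes> y)) A) (x \<otimes> (s \<otimes> y)))
      \<le> ?E (\<lambda>y. reach_prob g (Suc 0) (insert (x \<otimes> s \<otimes> y) (insert (x \<otimes> s) A)) (x \<otimes> s \<otimes> y))"
    proof (rule expectation_mono_pmf[where B = 1 and C = 1])
      fix y assume "y \<in> set_pmf (conv_pow G \<mu> (Suc k))"
      then have y: "y \<in> carrier G" using set_conv_pow[OF supp_\<mu>, of "Suc k"] by blast
      show "reach_prob g (Suc 0) (insert (x \<otimes> (s \<otimes> y)) A) (x \<otimes> (s \<otimes> y))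
        \<le> reach_prob g (Suc 0) (insert (x \<otimes> s \<otimes> y) (insert (x \<otimes> s) A)) (x \<otimes> s \<otimes> y)"
        unfolding m_assoc[OF Suc.prems s y] by (rule reach_prob_mono) auto
    qed (rule reach_prob_abs_le)+
    also have "\<dots> \<le> reach_prob g (Suc 0) (insert (x \<otimes> s) A) (x \<otimes> s)"
      using Suc.prems s by (intro Suc.IH) auto
    finally show "?E (\<lambda>y. reach_prob g (Suc 0) (insert (x \<otimes> (s \<otimes> y)) A) (x \<otimes> (s \<otimes> y)))
      \<le> reach_prob g 0 A (x \<otimes> s)"
      using Suc.prems s by (simp add: reach_prob_0)
    show "\<bar>?E (\<lambda>y. reach_prob g (Suc 0) (insert (x \<otimes> (s \<otimes> y)) A) (x \<otimes> (s \<otimes> y)))\<bar> \<le> 1"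
      using expectation_pmf_bounds[of _ "\<lambda>y. reach_prob g (Suc 0) (insert (x \<otimes> (s \<otimes> y)) A) (x \<otimes> (s \<otimes> y))"]
        reach_prob_bounds by (smt (verit))
  qed (rule reach_prob_abs_le)
  finally show ?case by (simp only: reach_prob_Suc[OF Suc.prems])
qed

text \<open>The upper bound is the same for every fixed time, so it survives averaging over
  times.\<close>

lemma reach_prob_cesaro:
  assumes "x \<in> carrier G"
  shows "measure_pmf.expectation (cesaro G \<mu> N) (\<lambda>y. reach_prob g (Suc 0) (insert (x \<otimes> y) A) (x \<otimes> y))
    \<le> reach_prob g (Suc 0) A x"
proof -
  have "measure_pmf.expectation (cesaro G \<mu> N) (\<lambda>y. reach_prob g (Suc 0) (insert (x \<otimes> y) A) (x \<otimes> y))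
    \<le> (\<Sum>k=1..Suc N. reach_prob g (Suc 0) A x) / real (Suc N)"
    unfolding expectation_cesaro[of "\<lambda>y. reach_prob g (Suc 0) (insert (x \<otimes> y) A) (x \<otimes> y)", OF reach_prob_abs_le]
  proof (intro divide_right_mono sum_mono)
    fix k assume "k \<in> {1..Suc N}"
    then obtain j where "k = Suc j" by (cases k) auto
    then show "measure_pmf.expectation (conv_pow G \<mu> k) (\<lambda>y. reach_prob g (Suc 0) (insert (x \<otimes> y) A) (x \<otimes> y))
      \<le> reach_prob g (Suc 0) A x" using reach_prob_conv_pow[OF assms, of j] by simp
  qed simp
  then show ?thesis by simp
qed

text \<open>Equality holds here, as positions before time \<open>n\<close> are not counted
  anyway.\<close>

lemma reach_prob_start:
  assumes "x \<in> carrier G"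
  shows "reach_prob g n A x = measure_pmf.expectation (conv_pow G \<mu> n) (\<lambda>y. reach_prob g (Suc 0) (insert (x \<otimes> y) A) (x \<otimes> y))"
  using assms
proof (induction n arbitrary: x)
  case 0
  then show ?case by (simp add: reach_prob_0)
next
  case (Suc n)
  let ?E = "measure_pmf.expectation (conv_pow G \<mu> n)"
  have "measure_pmf.expectation (conv_pow G \<mu> (Suc n)) (\<lambda>y. reach_prob g (Suc 0) (insert (x \<otimes> y) A) (x \<otimes> y))
     = measure_pmf.expectation \<mu> (\<lambda>s. ?E (\<lambda>y. reach_prob g (Suc 0) (insert (x \<otimes> (s \<otimes> y)) A) (x \<otimes> (s \<otimes> y))))"
    by (subst conv_pow.simps(2), subst expectation_bind_bounded[where B = 1])
       (auto simp: reach_prob_abs_le)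
  also have "\<dots> = measure_pmf.expectation \<mu> (\<lambda>s. reach_prob g n A (x \<otimes> s))"
  proof (intro integral_cong_AE)
    show "AE s in measure_pmf \<mu>. ?E (\<lambda>y. reach_prob g (Suc 0) (insert (x \<otimes> (s \<otimes> y)) A) (x \<otimes> (s \<otimes> y)))
        = reach_prob g n A (x \<otimes> s)"
      unfolding AE_measure_pmf_iff
    proof
      fix s assume "s \<in> set_pmf \<mu>"
      then have s: "s \<in> carrier G" using supp_\<mu> by auto
      have "reach_prob g n A (x \<otimes> s) = ?E (\<lambda>y. reach_prob g (Suc 0) (insert (x \<otimes> s \<otimes> y) A) (x \<otimes> s \<otimes> y))"
        using Suc.prems s by (intro Suc.IH) auto
      also have "\<dots> = ?E (\<lambda>y. reach_prob g (Suc 0) (insert (x \<otimes> (s \<otimes> y)) A) (x \<otimes> (s \<otimes> y)))"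
        using set_conv_pow[OF supp_\<mu>, of n] Suc.prems s
        by (intro integral_cong_AE) (auto simp: AE_measure_pmf_iff subset_iff m_assoc)
      finally show "?E (\<lambda>y. reach_prob g (Suc 0) (insert (x \<otimes> (s \<otimes> y)) A) (x \<otimes> (s \<otimes> y)))
        = reach_prob g n A (x \<otimes> s)" by simp
    qed
  qed auto
  finally show ?case by (simp only: reach_prob_Suc[OF Suc.prems])
qed

text \<open>The positions of the walk at suitable random times behave like independent elements with laws
  \<open>\<nu> (Suc i)\<close>, up to the total error \<open>\<Sum> \<epsilon>\<close>: given the present position \<open>x\<close>, the
  later position has law \<open>x \<nu> (Suc i)\<close>, which is close to \<open>\<nu> (Suc i)\<close> itself.\<close>
lemma reach_prob_ge_block:
  assumes \<nu>: "asymptotically_invariant G \<nu>" and ces: "\<And>i. \<nu> (Suc i) \<in> range (cesaro G \<mu>)"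
    and close: "\<And>i. shift_close_on_average G (\<nu> i) (\<nu> (Suc i)) (\<epsilon> i)"
  shows "measure_pmf.expectation (\<nu> i) (\<lambda>x.
      measure_pmf.prob (asymptotically_invariant.block \<nu> l (Suc i)) {L. g \<in> sgen G (A x \<union> set L)})
      - (\<Sum>j<l. \<epsilon> (i + j))
    \<le> measure_pmf.expectation (\<nu> i) (\<lambda>x. reach_prob g (Suc 0) (A x) x)"
proof (induction l arbitrary: i A)
  case 0
  interpret \<nu>: asymptotically_invariant G \<nu> by (rule \<nu>)
  \<comment> \<open>With no draws left, \<open>g\<close> must come from recorded positions, and then
    every path in the carrier reaches it.\<close>
  have "indicator {L. g \<in> sgen G (A x \<union> set L)} [] \<le> reach_prob g (Suc 0) (A x) x" for x
  proof (cases "g \<in> sgen G (A x)")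
    case True
    then have "reaches g (Suc 0) (A x) x = carrier_paths" by (auto simp: reaches_def intro: sgen_Un1)
    moreover have "measure paths carrier_paths = 1"
      using AE_carrier_paths carrier_paths_sets by (simp add: paths.prob_eq_1)
    ultimately show ?thesis by (simp add: reach_prob_def indicator_def)
  qed (simp add: reach_prob_bounds)
  then show ?case
    by (auto intro!: expectation_mono_pmf[where B = 1 and C = 1] simp: reach_prob_abs_le indicator_def)
next
  case (Suc l)
  interpret \<nu>: asymptotically_invariant G \<nu> by (rule \<nu>)
  let ?E = "\<lambda>i. measure_pmf.expectation (\<nu> i)"
  let ?b = "\<lambda>x y. measure_pmf.prob (\<nu>.block l (Suc (Suc i))) {L. g \<in> sgen G (insert y (A x) \<union> set L)}"
  let ?s = "\<Sum>j<l. \<epsilon> (Suc i + j)"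
  let ?r = "\<lambda>x y. reach_prob g (Suc 0) (insert y (A x)) y"
  have r1: "\<bar>?E (Suc i) (\<lambda>y. ?r x (f y))\<bar> \<le> 1" for x f
    using expectation_pmf_bounds[of "\<nu> (Suc i)" "\<lambda>y. ?r x (f y)"] reach_prob_bounds by (smt (verit))
  have b1: "0 \<le> ?E (Suc i) (?b x) \<and> ?E (Suc i) (?b x) \<le> 1" for x
    by (rule expectation_pmf_bounds) simp
  have "measure_pmf.prob (\<nu>.block (Suc l) (Suc i)) {L. g \<in> sgen G (A x \<union> set L)} = ?E (Suc i) (?b x)" for x
    by (simp add: prob_bind_pmf vimage_def)
  then have "?E i (\<lambda>x. measure_pmf.prob (\<nu>.block (Suc l) (Suc i)) {L. g \<in> sgen G (A x \<union> set L)})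
      - (\<Sum>j<Suc l. \<epsilon> (i + j)) = ?E i (\<lambda>x. ?E (Suc i) (?b x)) - ?s - \<epsilon> i"
    by (simp add: sum.lessThan_Suc_shift del: sum.lessThan_Suc \<nu>.block.simps)
  also have "?E i (\<lambda>x. ?E (Suc i) (?b x)) - ?s = ?E i (\<lambda>x. ?E (Suc i) (?b x) - ?s)"
  proof -
    have "integrable (measure_pmf (\<nu> i)) (\<lambda>x. ?E (Suc i) (?b x))"
      by (rule integrable_pmf_bounded[where B = 1]) (use b1 in auto)
    then show ?thesis by simp
  qed
  \<comment> \<open>For each fixed \<open>x\<close>, the induction hypothesis is used with
    \<open>y\<close> as present position and \<open>insert y (A x)\<close> recorded.\<close>
  also have "\<dots> \<le> ?E i (\<lambda>x. ?E (Suc i) (?r x))"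
  proof (rule expectation_mono_pmf[where B = "1 + \<bar>?s\<bar>" and C = 1])
    fix x
    show "?E (Suc i) (?b x) - ?s \<le> ?E (Suc i) (?r x)" by (rule Suc.IH)
    show "\<bar>?E (Suc i) (?b x) - ?s\<bar> \<le> 1 + \<bar>?s\<bar>" using b1[of x] by linarith
  qed (rule r1)
  \<comment> \<open>The idealised position \<open>y\<close> becomes the actual one
    \<open>x \<otimes> y\<close>; the integrand depends on \<open>x\<close> through
    \<open>A x\<close>, hence closeness of joint laws.\<close>
  also have "?E i (\<lambda>x. ?E (Suc i) (?r x)) - \<epsilon> i \<le> ?E i (\<lambda>x. ?E (Suc i) (\<lambda>y. ?r x (x \<otimes> y)))"
  proof -
    have "\<bar>?E i (\<lambda>x. ?E (Suc i) (\<lambda>y. ?r x (x \<otimes> y))) - ?E i (\<lambda>x. ?E (Suc i) (?r x))\<bar> \<le> \<epsilon> i"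
      by (rule shift_close_on_average_def[THEN iffD1, OF close, rule_format]) (rule reach_prob_bounds)
    then show ?thesis by linarith
  qed
  also have "?E i (\<lambda>x. ?E (Suc i) (\<lambda>y. ?r x (x \<otimes> y))) \<le> ?E i (\<lambda>x. reach_prob g (Suc 0) (A x) x)"
  proof (rule expectation_mono_pmf[where B = 1 and C = 1])
    fix x assume "x \<in> set_pmf (\<nu> i)"
    then have x: "x \<in> carrier G" using \<nu>.supp by auto
    obtain N where "\<nu> (Suc i) = cesaro G \<mu> N" using ces by auto
    then show "?E (Suc i) (\<lambda>y. ?r x (x \<otimes> y)) \<le> reach_prob g (Suc 0) (A x) x"
      using reach_prob_cesaro[OF x] by simp
  qed (rule r1 reach_prob_abs_le)+
  finally show ?case by simp
qed

lemma reach_prob_eq_1: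
  assumes vp: "virtually_polycyclic G" and sym: "symmetric_measure G \<mu>" and L: "liouville G \<mu>"
    and g: "g \<in> carrier G"
  shows "reach_prob g n {} \<one> = 1"
proof (rule antisym)
  have inv: "map_pmf (m_inv G) \<mu> = \<mu>" by (rule map_inv_symmetric[OF supp_\<mu> sym])
  show "1 \<le> reach_prob g n {} \<one>"
  proof (rule field_le_epsilon)
    fix \<epsilon> :: real assume \<epsilon>: "0 < \<epsilon>"
    \<comment> \<open>The translation errors sum to at most half of \<open>\<epsilon>\<close>; the
      other half pays for stopping at a finite block.\<close>
    define \<delta> where "\<delta> i = \<epsilon> / 4 * (1 / 2) ^ i" for i :: nat
    obtain \<nu> where \<nu>: "\<nu> 0 = conv_pow G \<mu> n" "asymptotically_invariant G \<nu>"
      "\<And>i. \<nu> (Suc i) \<in> range (cesaro G \<mu>)"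
      "\<And>i. shift_close_on_average G (\<nu> i) (\<nu> (Suc i)) (\<delta> i)"
      by (rule asymptotically_invariant_sequence_exists[OF supp_\<mu> countable_carrier inv L
            set_conv_pow[OF supp_\<mu>] map_inv_conv_pow[OF supp_\<mu> inv], of \<delta> n])
         (use \<epsilon> in \<open>auto simp: \<delta>_def\<close>)
    interpret \<nu>: asymptotically_invariant G \<nu> by (rule \<nu>(2))
    \<comment> \<open>Index 0 is the law of the walk at time \<open>n\<close>. That position is
      recorded, but the bound relies only on the draws after it.\<close>
    have "(\<lambda>l. \<nu>.hit (Suc 0) l {g}) \<longlonglongrightarrow> 1"
      using \<nu>.hit_surely_virtually_polycyclic[OF vp g] by (simp add: \<nu>.hit_surely_def)
    then have "eventually (\<lambda>l. 1 - \<epsilon> / 2 < \<nu>.hit (Suc 0) l {g}) sequentially"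
      by (rule order_tendstoD) (use \<epsilon> in simp)
    then obtain l where l: "1 - \<epsilon> / 2 < \<nu>.hit (Suc 0) l {g}" by (auto simp: eventually_sequentially)
    have "(\<Sum>j<l. \<delta> (0 + j)) = \<epsilon> / 4 * (\<Sum>j<l. (1 / 2) ^ j)"
      by (simp add: \<delta>_def sum_distrib_left)
    also have "(\<Sum>j<l. (1 / 2 :: real) ^ j) \<le> 2"
      by (simp add: geometric_sum)
    finally have sum: "(\<Sum>j<l. \<delta> (0 + j)) \<le> \<epsilon> / 2" using \<epsilon> by simp
    let ?E = "measure_pmf.expectation (\<nu> 0)"
    have "\<nu>.hit (Suc 0) l {g} = ?E (\<lambda>x. \<nu>.hit (Suc 0) l {g})" by simp
    also have "\<dots> \<le> ?E (\<lambda>x. measure_pmf.prob (\<nu>.block l (Suc 0)) {L. g \<in> sgen G ({x} \<union> set L)})"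
    proof (rule expectation_mono_pmf[where B = 1 and C = 1])
      fix x show "\<nu>.hit (Suc 0) l {g} \<le> measure_pmf.prob (\<nu>.block l (Suc 0)) {L. g \<in> sgen G ({x} \<union> set L)}"
        using \<nu>.hit_le_union[of "Suc 0" l "{g}" "{x}"] by simp
    qed (simp_all add: \<nu>.hit_bounds)
    finally have "1 - \<epsilon> / 2 - (\<Sum>j<l. \<delta> (0 + j)) \<le>
        ?E (\<lambda>x. measure_pmf.prob (\<nu>.block l (Suc 0)) {L. g \<in> sgen G ({x} \<union> set L)}) - (\<Sum>j<l. \<delta> (0 + j))"
      using l by simp
    also have "\<dots> \<le> ?E (\<lambda>x. reach_prob g (Suc 0) {x} x)"
      by (rule reach_prob_ge_block[OF \<nu>(2-4), where A = "\<lambda>x. {x}"])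
    also have "\<dots> = ?E (\<lambda>x. reach_prob g (Suc 0) {\<one> \<otimes> x} (\<one> \<otimes> x))"
      using \<nu>.supp by (intro integral_cong_AE) (auto simp: AE_measure_pmf_iff subset_iff)
    also have "\<dots> = reach_prob g n {} \<one>" unfolding \<nu>(1) by (rule reach_prob_start[symmetric]) simp
    finally show "1 \<le> reach_prob g n {} \<one> + \<epsilon>" using sum by simp
  qed
qed (simp add: reach_prob_bounds)

end

theorem mainTheorem9:
  fixes G :: "('a, 'b) monoid_scheme" and \<mu> :: "'a pmf"
  assumes "group G"
    and "virtually_polycyclic G"
    and "set_pmf \<mu> \<subseteq> carrier G"
    and "symmetric_measure G \<mu>"
    and "generate G (set_pmf \<mu>) = carrier G"
    and "liouville G \<mu>"
  shows "algebraically_recurrent G \<mu>"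
proof -
  interpret group G by fact
  \<comment> \<open>A discrete law has countable support, and so the group generated by it is
    countable.\<close>
  have "countable (carrier G)"
    using countable_generate[of "set_pmf \<mu>"] assms(3,5) by simp
  then interpret countable_group_walk G \<mu> by unfold_locales (use assms(3) in auto)
  show ?thesis
    unfolding algebraically_recurrent_def
  proof
    fix n
    let ?R = "\<lambda>\<omega>. {rw_pos G \<omega> m | m. n \<le> m}"
    have R: "{\<one>\<^bsub>G\<^esub> \<otimes>\<^bsub>G\<^esub> rw_pos G \<omega> m | m. n \<le> m} = ?R \<omega>" if "\<omega> \<in> carrier_paths" for \<omega>
      using rw_pos_closed[OF that] by simp
    have "AE \<omega> in paths. \<forall>g\<in>carrier G. g \<in> sgen G (?R \<omega>)"
    proof (subst AE_ball_countable[OF \<open>countable (carrier G)\<close>], intro ballI)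
      fix g assume g: "g \<in> carrier G"
      have "AE \<omega> in paths. \<omega> \<in> reaches g n {} \<one>\<^bsub>G\<^esub>"
        using reach_prob_eq_1[OF assms(2,4,6) g, of n] reaches_sets
        by (simp add: reach_prob_def paths.prob_eq_1)
      then show "AE \<omega> in paths. g \<in> sgen G (?R \<omega>)"
        by (rule AE_mp) (auto simp: reaches_def R)
    qed
    then show "AE \<omega> in paths. sgen G (?R \<omega>) = carrier G"
      using AE_carrier_paths
    proof eventually_elim
      case (elim \<omega>)
      have "?R \<omega> \<subseteq> carrier G" using rw_pos_closed[OF elim(2)] by auto
      with elim(1) show ?case using sgen_closed by blast
    qed
  qed
qed

end
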